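(* Consider the Gardner equation with small parameter $\varepsilon$, $$w_t-6(w+\varepsilon w^2)w_x+w_{xxx}=0,$$ for a function $w=w(x,t)$. Modulo $o(\varepsilon)$, its first-order approximate symmetries $X=X_0+\varepsilon X_1$ are exactly the real linear combinations of the seven operators $$\mathbf v_1=\partial_x,\quad \mathbf v_2=\partial_t,\quad \mathbf v_3=6t\,\partial_x+(2\varepsilon w-1)\,\partial_w,\quad \mathbf v_4=\varepsilon\,\partial_x,\quad \mathbf v_5=\varepsilon\,\partial_t,$$ $$\mathbf v_6=\varepsilon(6t\,\partial_x-\partial_w),\quad \mathbf v_7=\varepsilon(x\,\partial_x+3t\,\partial_t-2w\,\partial_w).$$ These operators span a seven-dimensional approximate Lie algebra: in the first order of precision (i.e. modulo $o(\varepsilon)$) their commutators are $$[\mathbf v_1,\mathbf v_7]=\mathbf v_4,\quad [\mathbf v_2,\mathbf v_3]=6\mathbf v_1,\quad [\mathbf v_2,\mathbf v_6]=6\mathbf v_4,\quad [\mathbf v_2,\mathbf v_7]=3\mathbf v_5,\quad [\mathbf v_3,\mathbf v_5]=-6\mathbf v_4,\quad [\mathbf v_3,\mathbf v_7]=-2\mathbf v_6,$$ and all other commutators $[\mathbf v_i,\mathbf v_j]$ with $i<j$ are zero.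
   Context: All objects depending on $\varepsilon$ are considered modulo $o(\varepsilon)$, where $f(z,\varepsilon)=o(\varepsilon)$ means $\lim_{\varepsilon\to0} f(z,\varepsilon)/\varepsilon=0$; thus $\varepsilon^2$-terms are discarded. Write the equation as $F_0+\varepsilon F_1\approx 0$ with $F_0=w_t-6ww_x+w_{xxx}$ and $F_1=-6w^2w_x$, regarded as functions on the third-order jet space of functions $w(x,t)$. A first-order approximate symmetry is an operator $X=X_0+\varepsilon X_1$, where $X_i=\alpha_i\,\partial_x+\beta_i\,\partial_t+\eta_i\,\partial_w$ ($i=0,1$) and $\alpha_i,\beta_i,\eta_i$ are smooth functions of $(x,t,w)$, such that, with $X^{(3)}$ denoting the third-order prolongation, $\big[X^{(3)}(F_0+\varepsilon F_1)\big]_{F_0+\varepsilon F_1\approx 0}=o(\varepsilon)$. Equivalently, there is a function $\lambda$ on the jet space such that $X_0^{(3)}F_0=\lambda F_0$ identically, and $X_1^{(3)}F_0+X_0^{(3)}F_1=\lambda F_1$ whenever $F_0=0$. The commutator of two such operators is the usual commutator of vector fields taken modulo $o(\varepsilon)$. *)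

theory Defs
  imports "HOL-Analysis.Analysis"
begin

primrec C_k :: "nat \<Rightarrow> ('a::real_normed_vector \<Rightarrow> 'b::real_normed_vector) \<Rightarrow> bool" where
  "C_k 0 f \<longleftrightarrow> continuous_on UNIV f"
| "C_k (Suc k) f \<longleftrightarrow>
     (\<forall>p. f differentiable (at p)) \<and> (\<forall>h. C_k k (\<lambda>p. frechet_derivative f (at p) h))"

definition smooth :: "('a::real_normed_vector \<Rightarrow> 'b::real_normed_vector) \<Rightarrow> bool" where
  "smooth f \<longleftrightarrow> (\<forall>k. C_k k f)"

definition o_eps :: "(real \<Rightarrow> 'a::real_normed_vector) \<Rightarrow> bool" where
  "o_eps f \<longleftrightarrow> ((\<lambda>\<epsilon>. f \<epsilon> /\<^sub>R \<epsilon>) \<longlongrightarrow> 0) (at 0)"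


subsection \<open>Vector fields on the space of \<open>(x, t, w)\<close>\<close>

text \<open>The triple \<open>(\<alpha>, \<beta>, \<eta>)\<close> stands for \<open>\<alpha> \<partial>\<^sub>x + \<beta> \<partial>\<^sub>t + \<eta> \<partial>\<^sub>w\<close>.\<close>

type_synonym pt = "real \<times> real \<times> real"
type_synonym vfield = "pt \<Rightarrow> pt"

definition commutator :: "vfield \<Rightarrow> vfield \<Rightarrow> vfield" where
  "commutator X Y p = frechet_derivative Y (at p) (X p) - frechet_derivative X (at p) (Y p)"

text \<open>Operators depending on \<open>\<epsilon>\<close> are functions \<open>real \<Rightarrow> vfield\<close>.\<close>

definition first_order_op :: "vfield \<Rightarrow> vfield \<Rightarrow> real \<Rightarrow> vfield" where
  "first_order_op X0 X1 \<epsilon> p = X0 p + \<epsilon> *\<^sub>R X1 p"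

definition approx_eq :: "(real \<Rightarrow> vfield) \<Rightarrow> (real \<Rightarrow> vfield) \<Rightarrow> bool" (infix "\<approx>\<^sub>\<epsilon>" 50) where
  "X \<approx>\<^sub>\<epsilon> Y \<longleftrightarrow> (\<forall>p. o_eps (\<lambda>\<epsilon>. X \<epsilon> p - Y \<epsilon> p))"

definition op_commutator :: "(real \<Rightarrow> vfield) \<Rightarrow> (real \<Rightarrow> vfield) \<Rightarrow> real \<Rightarrow> vfield" where
  "op_commutator X Y \<epsilon> = commutator (X \<epsilon>) (Y \<epsilon>)"

definition op_scale :: "real \<Rightarrow> (real \<Rightarrow> vfield) \<Rightarrow> real \<Rightarrow> vfield" where
  "op_scale a X \<epsilon> p = a *\<^sub>R X \<epsilon> p"

definition op_zero :: "real \<Rightarrow> vfield" where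
  "op_zero \<epsilon> p = 0"

definition lin_comb :: "nat \<Rightarrow> (nat \<Rightarrow> real \<Rightarrow> vfield) \<Rightarrow> (nat \<Rightarrow> real) \<Rightarrow> real \<Rightarrow> vfield" where
  "lin_comb n v c \<epsilon> p = (\<Sum>i = 1..n. c i *\<^sub>R v i \<epsilon> p)"

text \<open>Bilinearity, antisymmetry and the Jacobi identity are inherited from the commutator of
  vector fields; what has to be required is that the span is closed modulo \<open>o(\<epsilon>)\<close>.\<close>

definition spans_approx_lie_algebra_of_dim :: "nat \<Rightarrow> (nat \<Rightarrow> real \<Rightarrow> vfield) \<Rightarrow> bool" where
  "spans_approx_lie_algebra_of_dim n v \<longleftrightarrow>
     (\<forall>c. lin_comb n v c \<approx>\<^sub>\<epsilon> op_zero \<longrightarrow> (\<forall>i\<in>{1..n}. c i = 0)) \<and>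
     (\<forall>a b. \<exists>c. op_commutator (lin_comb n v a) (lin_comb n v b) \<approx>\<^sub>\<epsilon> lin_comb n v c)"


subsection \<open>The third-order jet space and prolongation\<close>

datatype jcoord = Jx | Jt | Jw | Jwx | Jwt | Jwxx | Jwxt | Jwtt | Jwxxx | Jwxxt | Jwxtt | Jwttt

instance jcoord :: finite
proof
  have "(UNIV :: jcoord set) \<subseteq>
      {Jx, Jt, Jw, Jwx, Jwt, Jwxx, Jwxt, Jwtt, Jwxxx, Jwxxt, Jwxtt, Jwttt}"
    using jcoord.exhaust by blast
  then show "finite (UNIV :: jcoord set)"
    by (rule finite_subset) simp
qed

type_synonym jet = "real ^ jcoord"

text \<open>Total derivatives. The components in the third-order directions, which would involve
  fourth-order coordinates, are cut off: the operators are only meaningful for, and only applied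
  to, functions of the jet coordinates of order at most two.\<close>

definition total_x :: "(jet \<Rightarrow> real) \<Rightarrow> jet \<Rightarrow> real" where
  "total_x f z = frechet_derivative f (at z)
     (\<chi> c. case c of Jx \<Rightarrow> 1 | Jt \<Rightarrow> 0 | Jw \<Rightarrow> z $ Jwx
        | Jwx \<Rightarrow> z $ Jwxx | Jwt \<Rightarrow> z $ Jwxt
        | Jwxx \<Rightarrow> z $ Jwxxx | Jwxt \<Rightarrow> z $ Jwxxt | Jwtt \<Rightarrow> z $ Jwxtt
        | Jwxxx \<Rightarrow> 0 | Jwxxt \<Rightarrow> 0 | Jwxtt \<Rightarrow> 0 | Jwttt \<Rightarrow> 0)"

definition total_t :: "(jet \<Rightarrow> real) \<Rightarrow> jet \<Rightarrow> real" where
  "total_t f z = frechet_derivative f (at z)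
     (\<chi> c. case c of Jx \<Rightarrow> 0 | Jt \<Rightarrow> 1 | Jw \<Rightarrow> z $ Jwt
        | Jwx \<Rightarrow> z $ Jwxt | Jwt \<Rightarrow> z $ Jwtt
        | Jwxx \<Rightarrow> z $ Jwxxt | Jwxt \<Rightarrow> z $ Jwxtt | Jwtt \<Rightarrow> z $ Jwttt
        | Jwxxx \<Rightarrow> 0 | Jwxxt \<Rightarrow> 0 | Jwxtt \<Rightarrow> 0 | Jwttt \<Rightarrow> 0)"

definition base :: "jet \<Rightarrow> pt" where
  "base z = (z $ Jx, z $ Jt, z $ Jw)"

definition coef_x :: "vfield \<Rightarrow> jet \<Rightarrow> real" where "coef_x X z = fst (X (base z))"
definition coef_t :: "vfield \<Rightarrow> jet \<Rightarrow> real" where "coef_t X z = fst (snd (X (base z)))"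
definition coef_w :: "vfield \<Rightarrow> jet \<Rightarrow> real" where "coef_w X z = snd (snd (X (base z)))"

text \<open>One step of the prolongation formula: \<open>zeta\<close> is the coefficient belonging to a derivative
  \<open>w\<^sub>J\<close>, and \<open>a\<close>, \<open>b\<close> are the coordinates \<open>w\<^sub>J\<^sub>x\<close>, \<open>w\<^sub>J\<^sub>t\<close>; the result is the
  coefficient belonging to \<open>w\<^sub>J\<^sub>x\<close> (\<open>prol_x\<close>) or \<open>w\<^sub>J\<^sub>t\<close> (\<open>prol_t\<close>).\<close>

definition prol_x :: "vfield \<Rightarrow> (jet \<Rightarrow> real) \<Rightarrow> jcoord \<Rightarrow> jcoord \<Rightarrow> jet \<Rightarrow> real" where
  "prol_x X zeta a b z =
     total_x zeta z - z $ a * total_x (coef_x X) z - z $ b * total_x (coef_t X) z"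

definition prol_t :: "vfield \<Rightarrow> (jet \<Rightarrow> real) \<Rightarrow> jcoord \<Rightarrow> jcoord \<Rightarrow> jet \<Rightarrow> real" where
  "prol_t X zeta a b z =
     total_t zeta z - z $ a * total_t (coef_x X) z - z $ b * total_t (coef_t X) z"

fun prol_coef :: "vfield \<Rightarrow> jcoord \<Rightarrow> jet \<Rightarrow> real" where
  "prol_coef X Jx = coef_x X"
| "prol_coef X Jt = coef_t X"
| "prol_coef X Jw = coef_w X"
| "prol_coef X Jwx = prol_x X (coef_w X) Jwx Jwt"
| "prol_coef X Jwt = prol_t X (coef_w X) Jwx Jwt"
| "prol_coef X Jwxx = prol_x X (prol_x X (coef_w X) Jwx Jwt) Jwxx Jwxt"
| "prol_coef X Jwxt = prol_t X (prol_x X (coef_w X) Jwx Jwt) Jwxx Jwxt"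
| "prol_coef X Jwtt = prol_t X (prol_t X (coef_w X) Jwx Jwt) Jwxt Jwtt"
| "prol_coef X Jwxxx =
     prol_x X (prol_x X (prol_x X (coef_w X) Jwx Jwt) Jwxx Jwxt) Jwxxx Jwxxt"
| "prol_coef X Jwxxt =
     prol_t X (prol_x X (prol_x X (coef_w X) Jwx Jwt) Jwxx Jwxt) Jwxxx Jwxxt"
| "prol_coef X Jwxtt =
     prol_t X (prol_t X (prol_x X (coef_w X) Jwx Jwt) Jwxx Jwxt) Jwxxt Jwxtt"
| "prol_coef X Jwttt =
     prol_t X (prol_t X (prol_t X (coef_w X) Jwx Jwt) Jwxt Jwtt) Jwxtt Jwttt"

definition prolongation3 :: "vfield \<Rightarrow> (jet \<Rightarrow> real) \<Rightarrow> jet \<Rightarrow> real" where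
  "prolongation3 X G z = frechet_derivative G (at z) (\<chi> c. prol_coef X c z)"


subsection \<open>Approximate symmetries of the Gardner equation\<close>

definition F0 :: "jet \<Rightarrow> real" where
  "F0 z = z $ Jwt - 6 * z $ Jw * z $ Jwx + z $ Jwxxx"

definition F1 :: "jet \<Rightarrow> real" where
  "F1 z = - 6 * (z $ Jw)\<^sup>2 * z $ Jwx"

definition F_gardner :: "real \<Rightarrow> jet \<Rightarrow> real" where
  "F_gardner \<epsilon> z = F0 z + \<epsilon> * F1 z"

text \<open>The restriction to \<open>F\<^sub>0 + \<epsilon> F\<^sub>1 \<approx> 0\<close> means: along every family of jets \<open>z \<epsilon>\<close> that
  converges as \<open>\<epsilon> \<rightarrow> 0\<close> and satisfies the equation up to \<open>o(\<epsilon>)\<close>. Without convergence the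
  \<open>o(\<epsilon>)\<close> error in the equation could be amplified by an unbounded factor.\<close>

definition approx_symmetry :: "vfield \<Rightarrow> vfield \<Rightarrow> bool" where
  "approx_symmetry X0 X1 \<longleftrightarrow> smooth X0 \<and> smooth X1 \<and>
     (\<forall>z z0. (z \<longlongrightarrow> z0) (at 0) \<longrightarrow> o_eps (\<lambda>\<epsilon>. F_gardner \<epsilon> (z \<epsilon>)) \<longrightarrow>
        o_eps (\<lambda>\<epsilon>. prolongation3 (first_order_op X0 X1 \<epsilon>) (F_gardner \<epsilon>) (z \<epsilon>)))"

definition gardner_op :: "nat \<Rightarrow> real \<Rightarrow> vfield" where
  "gardner_op i \<epsilon> = (\<lambda>(x, t, w).
     if i = 1 then (1, 0, 0)
     else if i = 2 then (0, 1, 0)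
     else if i = 3 then (6 * t, 0, 2 * \<epsilon> * w - 1)
     else if i = 4 then (\<epsilon>, 0, 0)
     else if i = 5 then (0, \<epsilon>, 0)
     else if i = 6 then \<epsilon> *\<^sub>R (6 * t, 0, - 1)
     else if i = 7 then \<epsilon> *\<^sub>R (x, 3 * t, - 2 * w)
     else (0, 0, 0))"

end

theory Submission
  imports Defs
begin

text \<open>
  Modulo \<open>o(\<epsilon>)\<close> the symmetry condition splits into two layers. At order zero it says that \<open>X0\<close> is a point
  symmetry of the KdV equation \<open>F0 = 0\<close>. At order one it says that \<open>X1\<close> satisfies the same linear
  determining equations with a source term produced by \<open>X0\<close> and \<open>F1\<close>. Both layers are obtained by
  testing the condition along the single family of jets in which a jet \<open>z0\<close> with \<open>F0 z0 = 0\<close> is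
  corrected by \<open>- \<epsilon> F1 z0\<close> in the coordinate \<open>w\<^sub>t\<close>, so that the perturbed equation holds exactly.

  One lemma, \<open>determining_equations_solution\<close>, serves both layers. It solves the KdV determining
  equations with the source \<open>w\<^sub>x (p w\<^sup>2 + q w)\<close> for constants \<open>p\<close>, \<open>q\<close>: a solution exists only if
  \<open>p = 0\<close>, and then it is a combination of the two translations, the Galilean boost and the KdV scaling,
  plus \<open>(q / 6) w \<partial>\<^sub>w\<close>. With \<open>p = q = 0\<close> it yields the four-dimensional KdV algebra for \<open>X0\<close>. If \<open>X0\<close>
  has scaling coefficient \<open>a\<close> and boost coefficient \<open>b\<close>, the source at order one has \<open>p = 12 a\<close> and
  \<open>q = 12 b\<close>. Hence the scaling is obstructed (\<open>a = 0\<close>), it survives only in the \<open>\<epsilon>\<close>-part, and the boost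
  has to be corrected by \<open>2 \<epsilon> b w \<partial>\<^sub>w\<close>; this is exactly the operator \<open>\<^bold>v\<^sub>3\<close>.

  All fields that occur are affine in \<open>(x, t, w)\<close> and belong to the family \<open>affine_field\<close>. For this family
  the prolongation of \<open>F0\<close> and \<open>F1\<close> is a short closed formula, which gives the converse direction, and
  the commutator is computed once for two arbitrary combinations of the seven operators
  (\<open>commutator_lin_comb\<close>); the commutator table is read off by inserting unit vectors.
\<close>

section \<open>Smooth maps\<close>

lemma smooth_differentiable: "smooth f \<Longrightarrow> f differentiable (at p)"
  unfolding smooth_def by (metis C_k.simps(2))

lemma smooth_directional:
  assumes "smooth f"
  shows "smooth (\<lambda>p. frechet_derivative f (at p) v)"
  using assms unfolding smooth_def by (metis C_k.simps(2))

lemma smooth_continuous: "smooth f \<Longrightarrow> continuous_on UNIV f"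
  unfolding smooth_def by (metis C_k.simps(1))

lemma smooth_has_derivative:
  "smooth f \<Longrightarrow> (f has_derivative frechet_derivative f (at p)) (at p)"
  using smooth_differentiable frechet_derivative_works by blast

lemma C_k_const: "C_k k (\<lambda>p. c)"
  by (induction k arbitrary: c) (auto simp: differentiable_const)

lemma smooth_affine:
  assumes "bounded_linear f"
  shows "smooth (\<lambda>p. c + f p)"
proof -
  have der: "((\<lambda>p. c + f p) has_derivative f) (at p)" for p
    using assms by (auto intro!: derivative_eq_intros simp: bounded_linear_imp_has_derivative)
  have "C_k k (\<lambda>p. c + f p)" for k
  proof (cases k)
    case 0
    then show ?thesis
      using der by (auto intro!: continuous_at_imp_continuous_on has_derivative_continuous)
  next
    case (Suc m)
    have "frechet_derivative (\<lambda>p. c + f p) (at p) = f" for p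
      using frechet_derivative_at[OF der] by simp
    moreover have "(\<lambda>p. c + f p) differentiable (at p)" for p
      using der differentiable_def by blast
    ultimately show ?thesis
      by (simp add: Suc C_k_const)
  qed
  then show ?thesis by (simp add: smooth_def)
qed

lemma smooth_linear_image:
  assumes L: "bounded_linear L" and f: "smooth f"
  shows "smooth (\<lambda>p. L (f p))"
proof -
  have "C_k k f \<Longrightarrow> C_k k (\<lambda>p. L (f p))" for k
    using f
  proof (induction k arbitrary: f)
    case 0
    then show ?case
      using linear_continuous_on_compose bounded_linear.continuous_on[OF L] by auto
  next
    case (Suc k)
    have der: "((\<lambda>q. L (f q)) has_derivative (\<lambda>h. L (frechet_derivative f (at p) h))) (at p)" for p
      using bounded_linear.has_derivative[OF L smooth_has_derivative[OF Suc.prems(2)]] .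
    have "frechet_derivative (\<lambda>q. L (f q)) (at p) = (\<lambda>h. L (frechet_derivative f (at p) h))" for p
      using frechet_derivative_at[OF der] by simp
    moreover have "(\<lambda>q. L (f q)) differentiable (at p)" for p
      using der differentiable_def by blast
    ultimately show ?case
      using Suc smooth_directional[OF Suc.prems(2)] by simp
  qed
  then show ?thesis using f by (simp add: smooth_def)
qed

lemma C_k_add_scale:
  "smooth f \<Longrightarrow> smooth g \<Longrightarrow> C_k k (\<lambda>p. f p + c *\<^sub>R g p)"
proof (induction k arbitrary: f g)
  case 0
  then show ?case
    by (simp add: smooth_continuous continuous_on_add continuous_on_scaleR)
next
  case (Suc k)
  have der: "((\<lambda>p. f p + c *\<^sub>R g p) has_derivative
      (\<lambda>h. frechet_derivative f (at p) h + c *\<^sub>R frechet_derivative g (at p) h)) (at p)" for p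
    using Suc.prems by (intro has_derivative_add has_derivative_scaleR_right smooth_has_derivative)
  have "frechet_derivative (\<lambda>p. f p + c *\<^sub>R g p) (at p)
      = (\<lambda>h. frechet_derivative f (at p) h + c *\<^sub>R frechet_derivative g (at p) h)" for p
    using frechet_derivative_at[OF der] by simp
  moreover have "(\<lambda>p. f p + c *\<^sub>R g p) differentiable (at p)" for p
    using der differentiable_def by blast
  ultimately show ?case
    using Suc by (simp add: smooth_directional)
qed

lemma smooth_add_scale:
  assumes "smooth f" "smooth g"
  shows "smooth (\<lambda>p. f p + c *\<^sub>R g p)"
  by (subst smooth_def) (intro allI C_k_add_scale assms)

lemma smooth_components:
  assumes "smooth X"
  obtains \<alpha> \<beta> \<eta> where "X = (\<lambda>p. (\<alpha> p, \<beta> p, \<eta> p))" "smooth \<alpha>" "smooth \<beta>" "smooth \<eta>"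
proof
  show "X = (\<lambda>p. (fst (X p), fst (snd (X p)), snd (snd (X p))))" by simp
  show "smooth (\<lambda>p. fst (X p))" "smooth (\<lambda>p. fst (snd (X p)))" "smooth (\<lambda>p. snd (snd (X p)))"
    by (intro smooth_linear_image[of fst, OF bounded_linear_fst]
      smooth_linear_image[of "\<lambda>q. fst (snd q)"] smooth_linear_image[of "\<lambda>q. snd (snd q)"]
      bounded_linear_compose[OF bounded_linear_fst bounded_linear_snd]
      bounded_linear_compose[OF bounded_linear_snd bounded_linear_snd] assms)+
qed

section \<open>Directional derivatives and their symmetry\<close>

definition dd :: "pt \<Rightarrow> (pt \<Rightarrow> real) \<Rightarrow> pt \<Rightarrow> real" where
  "dd v f p = frechet_derivative f (at p) v"

abbreviation "Dx \<equiv> dd (1, 0, 0)"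
abbreviation "Dt \<equiv> dd (0, 1, 0)"
abbreviation "Dw \<equiv> dd (0, 0, 1)"

lemma smooth_dd [intro]: "smooth f \<Longrightarrow> smooth (dd v f)"
  unfolding dd_def[abs_def] by (rule smooth_directional)

lemma dd_unique: "(f has_derivative f') (at p) \<Longrightarrow> dd v f p = f' v"
  unfolding dd_def using frechet_derivative_at by metis

lemma dd_along_line:
  assumes "smooth f"
  shows "((\<lambda>s. f (p + s *\<^sub>R u)) has_real_derivative dd u f (p + s *\<^sub>R u)) (at s)"
proof -
  have lin: "linear (frechet_derivative f (at q))" for q
    using assms smooth_differentiable linear_frechet_derivative by blast
  have "((\<lambda>s. p + s *\<^sub>R u) has_derivative (\<lambda>h. h *\<^sub>R u)) (at s)"
    by (auto intro!: derivative_eq_intros)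
  from has_derivative_compose[OF this smooth_has_derivative[OF assms]]
  show ?thesis
    unfolding has_field_derivative_def dd_def
    by (simp add: linear_scale[OF lin] mult_commute_abs)
qed

text \<open>The second difference is symmetric in \<open>u\<close> and \<open>v\<close>, while the mean value theorem, applied
  first in the direction \<open>u\<close> and then in the direction \<open>v\<close>, expresses it by an iterated derivative
  in one fixed order. Using it in both orders and shrinking \<open>h\<close> gives Schwarz's theorem.\<close>

lemma second_difference_mvt:
  assumes f: "smooth f" and h: "h > 0"
  obtains a b where "0 < a" "a < h" "0 < b" "b < h"
    "f (p + h *\<^sub>R u + h *\<^sub>R v) - f (p + h *\<^sub>R u) - f (p + h *\<^sub>R v) + f p
      = h * h * dd v (dd u f) (p + a *\<^sub>R u + b *\<^sub>R v)"
proof -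
  define g where "g s = f ((p + h *\<^sub>R v) + s *\<^sub>R u) - f (p + s *\<^sub>R u)" for s
  have "\<exists>a>0. a < h \<and> g h - g 0 = (h - 0) * (dd u f ((p + h *\<^sub>R v) + a *\<^sub>R u) - dd u f (p + a *\<^sub>R u))"
    unfolding g_def by (rule MVT2[OF h]) (intro DERIV_diff dd_along_line f)
  then obtain a where a: "0 < a" "a < h"
    "g h - g 0 = h * (dd u f ((p + h *\<^sub>R v) + a *\<^sub>R u) - dd u f (p + a *\<^sub>R u))" by auto
  have "\<exists>b>0. b < h \<and> dd u f ((p + a *\<^sub>R u) + h *\<^sub>R v) - dd u f ((p + a *\<^sub>R u) + 0 *\<^sub>R v)
      = (h - 0) * dd v (dd u f) ((p + a *\<^sub>R u) + b *\<^sub>R v)"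
    by (rule MVT2[OF h]) (intro dd_along_line smooth_dd f)
  then obtain b where b: "0 < b" "b < h"
    "dd u f (p + a *\<^sub>R u + h *\<^sub>R v) - dd u f (p + a *\<^sub>R u)
      = h * dd v (dd u f) (p + a *\<^sub>R u + b *\<^sub>R v)" by auto
  have "f (p + h *\<^sub>R u + h *\<^sub>R v) - f (p + h *\<^sub>R u) - f (p + h *\<^sub>R v) + f p = g h - g 0"
    by (simp add: g_def algebra_simps)
  also have "\<dots> = h * h * dd v (dd u f) (p + a *\<^sub>R u + b *\<^sub>R v)"
    using a(3) b(3) by (simp add: algebra_simps)
  finally show ?thesis using that a b by blast
qed

lemma dd_commute:
  assumes f: "smooth f"
  shows "dd u (dd v f) = dd v (dd u f)"
proof
  fix p
  let ?h = "\<lambda>n. 1 / real (Suc n)"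
  have "\<forall>n. \<exists>a b c d. 0 < a \<and> a < ?h n \<and> 0 < b \<and> b < ?h n \<and> 0 < c \<and> c < ?h n \<and> 0 < d \<and> d < ?h n \<and>
      dd v (dd u f) (p + a *\<^sub>R u + b *\<^sub>R v) = dd u (dd v f) (p + c *\<^sub>R v + d *\<^sub>R u)"
  proof
    fix n
    have h: "?h n > 0" by simp
    from second_difference_mvt[OF f h, of p u v] obtain a b where ab: "0 < a" "a < ?h n" "0 < b" "b < ?h n"
      and 1: "f (p + ?h n *\<^sub>R u + ?h n *\<^sub>R v) - f (p + ?h n *\<^sub>R u) - f (p + ?h n *\<^sub>R v) + f p
      = ?h n * ?h n * dd v (dd u f) (p + a *\<^sub>R u + b *\<^sub>R v)" by blast
    from second_difference_mvt[OF f h, of p v u] obtain c d where cd: "0 < c" "c < ?h n" "0 < d" "d < ?h n"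
      and 2: "f (p + ?h n *\<^sub>R v + ?h n *\<^sub>R u) - f (p + ?h n *\<^sub>R v) - f (p + ?h n *\<^sub>R u) + f p
      = ?h n * ?h n * dd u (dd v f) (p + c *\<^sub>R v + d *\<^sub>R u)" by blast
    have "?h n * ?h n * dd v (dd u f) (p + a *\<^sub>R u + b *\<^sub>R v)
        = ?h n * ?h n * dd u (dd v f) (p + c *\<^sub>R v + d *\<^sub>R u)"
      unfolding 1[symmetric] 2[symmetric] by (simp add: add_ac)
    then show "\<exists>a b c d. 0 < a \<and> a < ?h n \<and> 0 < b \<and> b < ?h n \<and> 0 < c \<and> c < ?h n \<and> 0 < d \<and> d < ?h n \<and>
      dd v (dd u f) (p + a *\<^sub>R u + b *\<^sub>R v) = dd u (dd v f) (p + c *\<^sub>R v + d *\<^sub>R u)"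
      using ab cd h by (intro exI[of _ a] exI[of _ b] exI[of _ c] exI[of _ d]) auto
  qed
  then obtain a b c d where B: "\<And>n. 0 < a n \<and> a n < ?h n" "\<And>n. 0 < b n \<and> b n < ?h n"
      "\<And>n. 0 < c n \<and> c n < ?h n" "\<And>n. 0 < d n \<and> d n < ?h n"
    and eq: "\<And>n. dd v (dd u f) (p + a n *\<^sub>R u + b n *\<^sub>R v) = dd u (dd v f) (p + c n *\<^sub>R v + d n *\<^sub>R u)"
    by metis
  have null: "s \<longlonglongrightarrow> 0" if "\<And>n. 0 < s n \<and> s n < ?h n" for s :: "nat \<Rightarrow> real"
    by (rule tendsto_sandwich[OF _ _ tendsto_const LIMSEQ_inverse_real_of_nat])
       (use that in \<open>auto intro!: always_eventually simp: less_imp_le inverse_eq_divide\<close>)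
  have cont: "isCont (dd v' (dd u' f)) p" for u' v'
    using smooth_continuous[of "dd v' (dd u' f)"] f
    by (metis smooth_dd continuous_on_eq_continuous_at open_UNIV UNIV_I)
  have "(\<lambda>n. p + a n *\<^sub>R u + b n *\<^sub>R v) \<longlonglongrightarrow> p + 0 *\<^sub>R u + 0 *\<^sub>R v"
       "(\<lambda>n. p + c n *\<^sub>R v + d n *\<^sub>R u) \<longlonglongrightarrow> p + 0 *\<^sub>R v + 0 *\<^sub>R u"
    by (intro tendsto_intros null B)+
  then have "(\<lambda>n. dd v (dd u f) (p + a n *\<^sub>R u + b n *\<^sub>R v)) \<longlonglongrightarrow> dd v (dd u f) p"
       "(\<lambda>n. dd u (dd v f) (p + c n *\<^sub>R v + d n *\<^sub>R u)) \<longlonglongrightarrow> dd u (dd v f) p"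
    using isCont_tendsto_compose[OF cont] by fastforce+
  then show "dd u (dd v f) p = dd v (dd u f) p"
    unfolding eq using LIMSEQ_unique by blast
qed

lemma dd_const [simp]: "dd u (\<lambda>p. c) = (\<lambda>p. 0)"
  by (auto simp: dd_def)

text \<open>This form of Schwarz's theorem propagates the vanishing of a first derivative to all higher
  ones; it is what removes the mixed derivatives from the determining equations.\<close>

lemma dd_dd_zero:
  assumes "smooth f" "dd u f = (\<lambda>p. 0)"
  shows "dd u (dd v f) = (\<lambda>p. 0)"
  using dd_commute[OF assms(1), of u v] by (simp add: assms(2))

lemma dd_add_scale:
  assumes "smooth f" "smooth g"
  shows "dd v (\<lambda>p. f p + c * g p) = (\<lambda>p. dd v f p + c * dd v g p)"
proof
  fix p
  show "dd v (\<lambda>p. f p + c * g p) p = dd v f p + c * dd v g p"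
    unfolding dd_def[of v f] dd_def[of v g]
    by (rule dd_unique) (intro has_derivative_add has_derivative_mult_right smooth_has_derivative assms)
qed

lemma has_derivative_partials:
  assumes "smooth f"
  shows "(f has_derivative (\<lambda>(a, b, c). a * Dx f p + b * Dt f p + c * Dw f p)) (at p)"
proof -
  have lin: "linear (frechet_derivative f (at p))"
    using assms smooth_differentiable linear_frechet_derivative by blast
  have "frechet_derivative f (at p) (a, b, c) = a * Dx f p + b * Dt f p + c * Dw f p" for a b c
  proof -
    have "(a, b, c) = a *\<^sub>R (1, 0, 0) + b *\<^sub>R (0, 1, 0) + c *\<^sub>R (0, 0, 1 :: real)" by simp
    then show ?thesis
      unfolding dd_def by (simp only: linear_add[OF lin] linear_scale[OF lin] real_scaleR_def)
  qed
  then have "frechet_derivative f (at p) = (\<lambda>(a, b, c). a * Dx f p + b * Dt f p + c * Dw f p)"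
    by auto
  then show ?thesis using smooth_has_derivative[OF assms, of p] by simp
qed

definition affine_fn :: "real \<Rightarrow> real \<Rightarrow> real \<Rightarrow> real \<Rightarrow> pt \<Rightarrow> real" where
  "affine_fn k a b c = (\<lambda>(x, t, w). k + a * x + b * t + c * w)"

lemma affine_fn_has_derivative:
  "(affine_fn k a b c has_derivative (\<lambda>(x, t, w). a * x + b * t + c * w)) (at p)"
  unfolding affine_fn_def split_def by (auto intro!: derivative_eq_intros)

lemma dd_affine_fn [simp]: "dd (u1, u2, u3) (affine_fn k a b c) = (\<lambda>p. a * u1 + b * u2 + c * u3)"
  by (rule ext) (simp add: dd_unique[OF affine_fn_has_derivative])

lemma smooth_affine_fn [simp]: "smooth (affine_fn k a b c)"
proof -
  have "bounded_linear (\<lambda>(x, t, w). a * x + b * t + c * w)"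
    using has_derivative_bounded_linear[OF affine_fn_has_derivative] .
  from smooth_affine[OF this, of k] show ?thesis
    by (simp add: affine_fn_def split_def add.assoc)
qed

lemma const_partials_affine:
  assumes f: "smooth f" and D: "Dx f = (\<lambda>p. a)" "Dt f = (\<lambda>p. b)" "Dw f = (\<lambda>p. c)"
  shows "\<exists>k. f = affine_fn k a b c"
proof -
  have "((\<lambda>q. f q - affine_fn 0 a b c q) has_derivative (\<lambda>h. 0)) (at p within UNIV)" for p
  proof -
    have "((\<lambda>q. f q - affine_fn 0 a b c q) has_derivative
      (\<lambda>h. (case h of (x, t, w) \<Rightarrow> x * Dx f p + t * Dt f p + w * Dw f p)
         - (case h of (x, t, w) \<Rightarrow> a * x + b * t + c * w))) (at p)"
      by (intro has_derivative_diff has_derivative_partials affine_fn_has_derivative f)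
    then show ?thesis by (simp add: D split_def mult.commute)
  qed
  from has_derivative_zero_constant[OF convex_UNIV this]
  obtain k where "\<And>q. f q = k + affine_fn 0 a b c q" by (auto simp: algebra_simps)
  then have "f = affine_fn k a b c" by (auto simp: affine_fn_def)
  then show ?thesis ..
qed

section \<open>Total derivatives on the jet space\<close>

text \<open>Naming the pullback along \<open>base\<close> gives the rewrite rules for total derivatives a constant to
  match on; the abstraction \<open>\<lambda>z. g (base z)\<close> itself would be matched in many useless ways.\<close>

definition on_jets :: "(pt \<Rightarrow> real) \<Rightarrow> jet \<Rightarrow> real" where
  "on_jets g z = g (base z)"

text \<open>These are the first three total \<open>x\<close>-derivatives of a function of \<open>(x, t, w)\<close>, expanded by
  the chain rule and with the mixed partial derivatives sorted.\<close>

definition jet_D1 :: "(pt \<Rightarrow> real) \<Rightarrow> jet \<Rightarrow> real" where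
  "jet_D1 g z = on_jets (Dx g) z + z $ Jwx * on_jets (Dw g) z"

definition jet_D2 :: "(pt \<Rightarrow> real) \<Rightarrow> jet \<Rightarrow> real" where
  "jet_D2 g z = on_jets (Dx (Dx g)) z + 2 * z $ Jwx * on_jets (Dw (Dx g)) z
     + (z $ Jwx)\<^sup>2 * on_jets (Dw (Dw g)) z + z $ Jwxx * on_jets (Dw g) z"

definition jet_D3 :: "(pt \<Rightarrow> real) \<Rightarrow> jet \<Rightarrow> real" where
  "jet_D3 g z = on_jets (Dx (Dx (Dx g))) z + 3 * z $ Jwx * on_jets (Dw (Dx (Dx g))) z
     + 3 * (z $ Jwx)\<^sup>2 * on_jets (Dw (Dw (Dx g))) z + (z $ Jwx) ^ 3 * on_jets (Dw (Dw (Dw g))) z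
     + 3 * z $ Jwxx * (on_jets (Dw (Dx g)) z + z $ Jwx * on_jets (Dw (Dw g)) z)
     + z $ Jwxxx * on_jets (Dw g) z"

lemma base_has_derivative:
  assumes "smooth g"
  shows "((on_jets g) has_derivative
    (\<lambda>h. h $ Jx * on_jets (Dx g) z + h $ Jt * on_jets (Dt g) z + h $ Jw * on_jets (Dw g) z)) (at z)"
proof -
  have "(base has_derivative (\<lambda>h. (h $ Jx, h $ Jt, h $ Jw))) (at z)"
    unfolding base_def[abs_def]
    by (intro has_derivative_Pair bounded_linear_imp_has_derivative bounded_linear_vec_nth)
  from has_derivative_compose[OF this has_derivative_partials[OF assms]]
  show ?thesis by (simp add: on_jets_def[abs_def])
qed

lemma nth_has_derivative: "((\<lambda>z::jet. z $ c) has_derivative (\<lambda>h. h $ c)) (at z)"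
  by (intro bounded_linear_imp_has_derivative bounded_linear_vec_nth)

lemma base_differentiable [simp]: "smooth g \<Longrightarrow> (on_jets g) differentiable (at z)"
  using base_has_derivative differentiable_def by blast

lemma nth_differentiable [simp]: "(\<lambda>z::jet. z $ c) differentiable (at z)"
  using nth_has_derivative differentiable_def by blast

lemma total_x_unique: "(f has_derivative f') (at z) \<Longrightarrow> total_x f z = f'
     (\<chi> c. case c of Jx \<Rightarrow> 1 | Jt \<Rightarrow> 0 | Jw \<Rightarrow> z $ Jwx
        | Jwx \<Rightarrow> z $ Jwxx | Jwt \<Rightarrow> z $ Jwxt
        | Jwxx \<Rightarrow> z $ Jwxxx | Jwxt \<Rightarrow> z $ Jwxxt | Jwtt \<Rightarrow> z $ Jwxtt
        | Jwxxx \<Rightarrow> 0 | Jwxxt \<Rightarrow> 0 | Jwxtt \<Rightarrow> 0 | Jwttt \<Rightarrow> 0)"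
  unfolding total_x_def using frechet_derivative_at by metis

lemma total_t_unique: "(f has_derivative f') (at z) \<Longrightarrow> total_t f z = f'
     (\<chi> c. case c of Jx \<Rightarrow> 0 | Jt \<Rightarrow> 1 | Jw \<Rightarrow> z $ Jwt
        | Jwx \<Rightarrow> z $ Jwxt | Jwt \<Rightarrow> z $ Jwtt
        | Jwxx \<Rightarrow> z $ Jwxxt | Jwxt \<Rightarrow> z $ Jwxtt | Jwtt \<Rightarrow> z $ Jwttt
        | Jwxxx \<Rightarrow> 0 | Jwxxt \<Rightarrow> 0 | Jwxtt \<Rightarrow> 0 | Jwttt \<Rightarrow> 0)"
  unfolding total_t_def using frechet_derivative_at by metis

lemma total_t_base:
  "smooth g \<Longrightarrow> total_t (on_jets g) z = on_jets (Dt g) z + z $ Jwt * on_jets (Dw g) z"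
  by (subst total_t_unique[OF base_has_derivative]) simp_all

lemma total_x_nth:
  "total_x (\<lambda>z. z $ c) z = (case c of Jx \<Rightarrow> 1 | Jt \<Rightarrow> 0 | Jw \<Rightarrow> z $ Jwx
        | Jwx \<Rightarrow> z $ Jwxx | Jwt \<Rightarrow> z $ Jwxt
        | Jwxx \<Rightarrow> z $ Jwxxx | Jwxt \<Rightarrow> z $ Jwxxt | Jwtt \<Rightarrow> z $ Jwxtt
        | Jwxxx \<Rightarrow> 0 | Jwxxt \<Rightarrow> 0 | Jwxtt \<Rightarrow> 0 | Jwttt \<Rightarrow> 0)"
  by (subst total_x_unique[OF nth_has_derivative]) simp

lemma total_x_const: "total_x (\<lambda>z. c) z = 0"
  by (simp add: total_x_def)

lemma total_x_add:
  assumes "f differentiable (at z)" "g differentiable (at z)"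
  shows "total_x (\<lambda>z. f z + g z) z = total_x f z + total_x g z"
  using total_x_unique[OF has_derivative_add[OF assms[THEN frechet_derivative_works[THEN iffD1]]]]
  by (simp add: total_x_def)

lemma total_x_diff:
  assumes "f differentiable (at z)" "g differentiable (at z)"
  shows "total_x (\<lambda>z. f z - g z) z = total_x f z - total_x g z"
  using total_x_unique[OF has_derivative_diff[OF assms[THEN frechet_derivative_works[THEN iffD1]]]]
  by (simp add: total_x_def)

lemma total_x_mult:
  assumes "f differentiable (at z)" "g differentiable (at z)"
  shows "total_x (\<lambda>z. f z * g z) z = f z * total_x g z + total_x f z * g z"
  using total_x_unique[OF has_derivative_mult[OF assms[THEN frechet_derivative_works[THEN iffD1]]]]
  by (simp add: total_x_def)

lemmas total_x_rules = total_x_const total_x_add total_x_diff total_x_mult total_x_nth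

lemma total_x_base:
  "smooth g \<Longrightarrow> total_x (on_jets g) z = on_jets (Dx g) z + z $ Jwx * on_jets (Dw g) z"
  by (subst total_x_unique[OF base_has_derivative]) simp_all

lemma jet_D1_differentiable: "smooth g \<Longrightarrow> jet_D1 g differentiable (at z)"
  unfolding jet_D1_def[abs_def] by (simp add: smooth_dd)

lemma jet_D2_differentiable: "smooth g \<Longrightarrow> jet_D2 g differentiable (at z)"
  unfolding jet_D2_def[abs_def] by (simp add: smooth_dd)

lemma total_x_jet_D1:
  assumes "smooth g"
  shows "total_x (jet_D1 g) z = jet_D2 g z"
proof -
  have "Dx (Dw g) = Dw (Dx g)" using assms by (rule dd_commute)
  then show ?thesis
    using assms unfolding jet_D1_def[abs_def]
    by (simp add: total_x_rules total_x_base smooth_dd jet_D2_def algebra_simps power2_eq_square)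
qed

lemma total_x_jet_D2:
  assumes "smooth g"
  shows "total_x (jet_D2 g) z = jet_D3 g z"
proof -
  have "Dx (Dw g) = Dw (Dx g)" "Dx (Dw (Dx g)) = Dw (Dx (Dx g))" "Dx (Dw (Dw g)) = Dw (Dw (Dx g))"
    using assms by (metis dd_commute smooth_dd)+
  then show ?thesis
    using assms unfolding jet_D2_def[abs_def]
    by (simp add: total_x_rules total_x_base smooth_dd jet_D3_def algebra_simps
      power2_eq_square power3_eq_cube)
qed

section \<open>Prolongation formulas\<close>

context
  fixes X :: vfield and \<alpha> \<beta> \<eta> :: "pt \<Rightarrow> real"
  assumes X: "X = (\<lambda>p. (\<alpha> p, \<beta> p, \<eta> p))"
    and smooth: "smooth \<alpha>" "smooth \<beta>" "smooth \<eta>"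
begin

lemma coef_simps:
  "coef_x X = on_jets \<alpha>" "coef_t X = on_jets \<beta>" "coef_w X = on_jets \<eta>"
  by (auto simp: X coef_x_def coef_t_def coef_w_def on_jets_def)

lemma total_x_coef:
  "total_x (coef_x X) z = jet_D1 \<alpha> z" "total_x (coef_t X) z = jet_D1 \<beta> z"
  "total_x (coef_w X) z = jet_D1 \<eta> z"
  using smooth by (simp_all add: coef_simps total_x_base jet_D1_def)

lemma prol_wt:
  "prol_coef X Jwt z = on_jets (Dt \<eta>) z + z $ Jwt * on_jets (Dw \<eta>) z
     - z $ Jwx * (on_jets (Dt \<alpha>) z + z $ Jwt * on_jets (Dw \<alpha>) z)
     - z $ Jwt * (on_jets (Dt \<beta>) z + z $ Jwt * on_jets (Dw \<beta>) z)"
  using smooth by (simp add: prol_t_def coef_simps total_t_base)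

lemma prol_wx:
  "prol_coef X Jwx = (\<lambda>z. jet_D1 \<eta> z - z $ Jwx * jet_D1 \<alpha> z - z $ Jwt * jet_D1 \<beta> z)"
  by (auto simp: prol_x_def total_x_coef)

text \<open>The terms in \<open>D\<alpha>\<close> and \<open>D\<beta>\<close> subtracted by each prolongation step add up with those that arise
  from differentiating the previous coefficient; the binomial coefficients are those of the
  Leibniz expansion of \<open>D\<^sup>n (\<eta> - \<alpha> w\<^sub>x - \<beta> w\<^sub>t) + \<alpha> D\<^sup>n w\<^sub>x + \<beta> D\<^sup>n w\<^sub>t\<close>.\<close>

lemma prol_wxx:
  "prol_coef X Jwxx = (\<lambda>z. jet_D2 \<eta> z - z $ Jwx * jet_D2 \<alpha> z - 2 * z $ Jwxx * jet_D1 \<alpha> z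
     - z $ Jwt * jet_D2 \<beta> z - 2 * z $ Jwxt * jet_D1 \<beta> z)"
proof
  fix z
  have "prol_coef X Jwxx z = total_x (prol_coef X Jwx) z - z $ Jwxx * jet_D1 \<alpha> z - z $ Jwxt * jet_D1 \<beta> z"
    by (simp add: prol_x_def[of X "prol_x _ _ _ _"] total_x_coef)
  then show "prol_coef X Jwxx z = jet_D2 \<eta> z - z $ Jwx * jet_D2 \<alpha> z - 2 * z $ Jwxx * jet_D1 \<alpha> z
     - z $ Jwt * jet_D2 \<beta> z - 2 * z $ Jwxt * jet_D1 \<beta> z"
    unfolding prol_wx using smooth
    by (simp add: total_x_rules jet_D1_differentiable total_x_jet_D1 algebra_simps)
qed

lemma prol_wxxx:
  "prol_coef X Jwxxx z = jet_D3 \<eta> z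
     - z $ Jwx * jet_D3 \<alpha> z - 3 * z $ Jwxx * jet_D2 \<alpha> z - 3 * z $ Jwxxx * jet_D1 \<alpha> z
     - z $ Jwt * jet_D3 \<beta> z - 3 * z $ Jwxt * jet_D2 \<beta> z - 3 * z $ Jwxxt * jet_D1 \<beta> z"
proof -
  have "prol_coef X Jwxxx z = total_x (prol_coef X Jwxx) z - z $ Jwxxx * jet_D1 \<alpha> z - z $ Jwxxt * jet_D1 \<beta> z"
    by (simp add: prol_x_def[of X "prol_x _ _ _ _" Jwxxx] total_x_coef)
  then show ?thesis
    unfolding prol_wxx using smooth
    by (simp add: total_x_rules jet_D1_differentiable jet_D2_differentiable
      total_x_jet_D1 total_x_jet_D2 algebra_simps)
qed

lemma prolongation3_F0:
  "prolongation3 X F0 z = prol_coef X Jwt z - 6 * on_jets \<eta> z * z $ Jwx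
     - 6 * z $ Jw * prol_coef X Jwx z + prol_coef X Jwxxx z"
proof -
  have "(F0 has_derivative (\<lambda>h. h $ Jwt - 6 * (h $ Jw * z $ Jwx + z $ Jw * h $ Jwx) + h $ Jwxxx)) (at z)"
    unfolding F0_def[abs_def]
    by (auto intro!: derivative_eq_intros nth_has_derivative simp: algebra_simps)
  from frechet_derivative_at[OF this, symmetric] have "prolongation3 X F0 z =
      prol_coef X Jwt z - 6 * (prol_coef X Jw z * z $ Jwx + z $ Jw * prol_coef X Jwx z)
        + prol_coef X Jwxxx z"
    by (simp only: prolongation3_def vec_lambda_beta)
  then show ?thesis
    by (simp only: prol_coef.simps(3) coef_simps) (simp only: algebra_simps)
qed

lemma prolongation3_F1:
  "prolongation3 X F1 z =
     - 12 * z $ Jw * on_jets \<eta> z * z $ Jwx - 6 * (z $ Jw)\<^sup>2 * prol_coef X Jwx z"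
proof -
  have "(F1 has_derivative (\<lambda>h. - 12 * z $ Jw * h $ Jw * z $ Jwx - 6 * (z $ Jw)\<^sup>2 * h $ Jwx)) (at z)"
    unfolding F1_def[abs_def]
    by (auto intro!: derivative_eq_intros nth_has_derivative simp: algebra_simps)
  from frechet_derivative_at[OF this, symmetric] have "prolongation3 X F1 z =
      - 12 * z $ Jw * prol_coef X Jw z * z $ Jwx - 6 * (z $ Jw)\<^sup>2 * prol_coef X Jwx z"
    by (simp only: prolongation3_def vec_lambda_beta)
  then show ?thesis
    by (simp only: prol_coef.simps(3) coef_simps)
qed

end

lemma F0_differentiable: "F0 differentiable (at z)"
  unfolding F0_def[abs_def] by simp

lemma F1_differentiable: "F1 differentiable (at z)"
  unfolding F1_def[abs_def] by simp

lemma prolongation3_F_gardner: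
  "prolongation3 X (F_gardner \<epsilon>) z = prolongation3 X F0 z + \<epsilon> * prolongation3 X F1 z"
proof -
  note d = F0_differentiable[of z] F1_differentiable[of z]
  have "(F_gardner \<epsilon> has_derivative
      (\<lambda>h. frechet_derivative F0 (at z) h + \<epsilon> * frechet_derivative F1 (at z) h)) (at z)"
    unfolding F_gardner_def[abs_def]
    using d[THEN frechet_derivative_works[THEN iffD1]]
    by (intro has_derivative_add has_derivative_mult_right)
  from frechet_derivative_at[OF this, symmetric] show ?thesis
    by (simp add: prolongation3_def)
qed

lemma prolongation3_first_order_op:
  assumes "smooth X0" "smooth X1"
  shows "prolongation3 (first_order_op X0 X1 \<epsilon>) F0 z = prolongation3 X0 F0 z + \<epsilon> * prolongation3 X1 F0 z"
    and "prolongation3 (first_order_op X0 X1 \<epsilon>) F1 z = prolongation3 X0 F1 z + \<epsilon> * prolongation3 X1 F1 z"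
proof -
  obtain \<alpha>0 \<beta>0 \<eta>0 where X0: "X0 = (\<lambda>p. (\<alpha>0 p, \<beta>0 p, \<eta>0 p))"
    and s0: "smooth \<alpha>0" "smooth \<beta>0" "smooth \<eta>0" using smooth_components[OF assms(1)] .
  obtain \<alpha>1 \<beta>1 \<eta>1 where X1: "X1 = (\<lambda>p. (\<alpha>1 p, \<beta>1 p, \<eta>1 p))"
    and s1: "smooth \<alpha>1" "smooth \<beta>1" "smooth \<eta>1" using smooth_components[OF assms(2)] .
  have X: "first_order_op X0 X1 \<epsilon> =
      (\<lambda>p. (\<alpha>0 p + \<epsilon> * \<alpha>1 p, \<beta>0 p + \<epsilon> * \<beta>1 p, \<eta>0 p + \<epsilon> * \<eta>1 p))"
    by (auto simp: first_order_op_def X0 X1)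
  have s: "smooth (\<lambda>p. f p + \<epsilon> * g p)" if "smooth f" "smooth g" for f g :: "pt \<Rightarrow> real"
    using smooth_add_scale[OF that, of \<epsilon>] by simp
  note S = s[OF s0(1) s1(1)] s[OF s0(2) s1(2)] s[OF s0(3) s1(3)]
  have lin: "on_jets (\<lambda>p. f p + \<epsilon> * g p) z = on_jets f z + \<epsilon> * on_jets g z" for f g
    by (simp add: on_jets_def)
  have D: "jet_D1 (\<lambda>p. f p + \<epsilon> * g p) z = jet_D1 f z + \<epsilon> * jet_D1 g z"
    "jet_D2 (\<lambda>p. f p + \<epsilon> * g p) z = jet_D2 f z + \<epsilon> * jet_D2 g z"
    "jet_D3 (\<lambda>p. f p + \<epsilon> * g p) z = jet_D3 f z + \<epsilon> * jet_D3 g z"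
    if "smooth f" "smooth g" for f g
    unfolding jet_D1_def jet_D2_def jet_D3_def
    by (simp_all add: dd_add_scale that smooth_dd lin algebra_simps)
  show "prolongation3 (first_order_op X0 X1 \<epsilon>) F0 z = prolongation3 X0 F0 z + \<epsilon> * prolongation3 X1 F0 z"
    unfolding prolongation3_F0[OF X S] prol_wt[OF X S] prol_wx[OF X S] prol_wxxx[OF X S]
      prolongation3_F0[OF X0 s0] prol_wt[OF X0 s0] prol_wx[OF X0 s0] prol_wxxx[OF X0 s0]
      prolongation3_F0[OF X1 s1] prol_wt[OF X1 s1] prol_wx[OF X1 s1] prol_wxxx[OF X1 s1]
    by (simp add: D s0 s1 dd_add_scale lin algebra_simps)
  show "prolongation3 (first_order_op X0 X1 \<epsilon>) F1 z = prolongation3 X0 F1 z + \<epsilon> * prolongation3 X1 F1 z"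
    unfolding prolongation3_F1[OF X S] prol_wx[OF X S]
      prolongation3_F1[OF X0 s0] prol_wx[OF X0 s0]
      prolongation3_F1[OF X1 s1] prol_wx[OF X1 s1]
    by (simp add: D s0 s1 lin algebra_simps)
qed

text \<open>Only the limit of the symmetry condition at \<open>\<epsilon> = 0\<close> is evaluated, so continuity in the jet
  is what turns the condition along a family of jets into one at the limiting jet.\<close>

lemma prolongation3_continuous:
  assumes "smooth X"
  shows "isCont (prolongation3 X F0) z" "isCont (prolongation3 X F1) z"
proof -
  obtain \<alpha> \<beta> \<eta> where X: "X = (\<lambda>p. (\<alpha> p, \<beta> p, \<eta> p))"
    and s: "smooth \<alpha>" "smooth \<beta>" "smooth \<eta>" using smooth_components[OF assms] .
  have j: "isCont (on_jets g) z" if "smooth g" for g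
    using base_has_derivative[OF that] by (rule has_derivative_continuous)
  have D: "isCont (jet_D1 g) z" "isCont (jet_D2 g) z" "isCont (jet_D3 g) z" if "smooth g" for g
    unfolding jet_D1_def[abs_def] jet_D2_def[abs_def] jet_D3_def[abs_def]
    by (intro continuous_intros j smooth_dd that)+
  show "isCont (prolongation3 X F0) z"
    unfolding prolongation3_F0[OF X s, abs_def] prol_wt[OF X s] prol_wx[OF X s] prol_wxxx[OF X s]
    by (intro continuous_intros j D smooth_dd s)
  show "isCont (prolongation3 X F1) z"
    unfolding prolongation3_F1[OF X s, abs_def] prol_wx[OF X s]
    by (intro continuous_intros j D s)
qed

section \<open>The determining equations of the KdV equation\<close>

text \<open>The parameters \<open>d\<close>, \<open>e\<close>, \<open>b\<close> belong to the translations in \<open>x\<close> and \<open>t\<close> and to the Galilean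
  boost, and \<open>a\<close> to the scaling of \<open>(x, t)\<close>. The weight \<open>m\<close> of \<open>w\<close> is kept free: it is \<open>- 2 a\<close> for
  the symmetries of the KdV equation, but the correction of the boost at order \<open>\<epsilon>\<close> changes it.\<close>

definition affine_field :: "real \<Rightarrow> real \<Rightarrow> real \<Rightarrow> real \<Rightarrow> real \<Rightarrow> vfield" where
  "affine_field a b d e m = (\<lambda>(x, t, w). (a * x + 6 * b * t + d, 3 * a * t + e, m * w - b))"

text \<open>On \<open>F0 = 0\<close> the coordinate \<open>w\<^sub>t\<close> is eliminated; on jets with \<open>w\<^sub>x\<^sub>t = 0\<close> the remaining
  condition is a polynomial in \<open>w\<^sub>x\<close>, \<open>w\<^sub>x\<^sub>x\<close>, \<open>w\<^sub>x\<^sub>x\<^sub>x\<close>, \<open>w\<^sub>x\<^sub>x\<^sub>t\<close> whose coefficients are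
  functions of \<open>(x, t, w)\<close> and must all vanish. Instead of comparing coefficients, the polynomial
  is evaluated at a few jets. The coefficients of \<open>w\<^sub>x\<^sub>x\<^sub>t\<close>, \<open>w\<^sub>x w\<^sub>x\<^sub>x\<^sub>t\<close>, \<open>w\<^sub>x\<^sub>x\<^sup>2\<close> and
  \<open>w\<^sub>x\<^sub>x\<^sub>x\<close> make \<open>\<beta>\<close> depend on \<open>t\<close> alone, make \<open>\<alpha>\<close> independent of \<open>w\<close>, and give \<open>\<beta>\<^sub>t = 3 \<alpha>\<^sub>x\<close>,
  hence \<open>\<alpha>\<^sub>x\<^sub>x = 0\<close>; the coefficient of \<open>w\<^sub>x\<close> then expresses \<open>\<eta>\<close> by \<open>\<alpha>\<close>, with \<open>p w\<^sup>2 / 6\<close> as its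
  only term quadratic in \<open>w\<close>. Since \<open>\<eta>\<^sub>w\<^sub>w = 0\<close> by the coefficient of \<open>w\<^sub>x w\<^sub>x\<^sub>x\<close>, this forces
  \<open>p = 0\<close>, and the constant coefficient shows that \<open>\<alpha>\<^sub>x\<close> and \<open>\<alpha>\<^sub>t\<close> are constant.\<close>

lemma determining_equations_solution:
  assumes X: "X = (\<lambda>p. (\<alpha> p, \<beta> p, \<eta> p))"
    and smooth: "smooth \<alpha>" "smooth \<beta>" "smooth \<eta>"
    and inv: "\<And>z. F0 z = 0 \<Longrightarrow>
      prolongation3 X F0 z + z $ Jwx * (p * (z $ Jw)\<^sup>2 + q * z $ Jw) = 0"
  shows "p = 0 \<and> (\<exists>a b d e. X = affine_field a b d e (q / 6 - 2 * a))"
proof -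
  define jet :: "pt \<Rightarrow> real \<Rightarrow> real \<Rightarrow> real \<Rightarrow> real \<Rightarrow> jet" where
    "jet = (\<lambda>(x, t, w) wx wxx wxxx wxxt. \<chi> c. case c of Jx \<Rightarrow> x | Jt \<Rightarrow> t | Jw \<Rightarrow> w
        | Jwx \<Rightarrow> wx | Jwt \<Rightarrow> 6 * w * wx - wxxx
        | Jwxx \<Rightarrow> wxx | Jwxt \<Rightarrow> 0 | Jwtt \<Rightarrow> 0
        | Jwxxx \<Rightarrow> wxxx | Jwxxt \<Rightarrow> wxxt | Jwxtt \<Rightarrow> 0 | Jwttt \<Rightarrow> 0)"
  have on_jet: "on_jets f (jet P wx wxx wxxx wxxt) = f P" for f P wx wxx wxxx wxxt
    by (cases P) (simp add: jet_def on_jets_def base_def)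
  have nth: "jet P wx wxx wxxx wxxt $ Jw = snd (snd P)" "jet P wx wxx wxxx wxxt $ Jwx = wx"
    "jet P wx wxx wxxx wxxt $ Jwt = 6 * snd (snd P) * wx - wxxx" "jet P wx wxx wxxx wxxt $ Jwxx = wxx"
    "jet P wx wxx wxxx wxxt $ Jwxt = 0"
    "jet P wx wxx wxxx wxxt $ Jwxxx = wxxx" "jet P wx wxx wxxx wxxt $ Jwxxt = wxxt"
    for P wx wxx wxxx wxxt by (simp_all add: jet_def split_def)
  have F0: "F0 (jet P wx wxx wxxx wxxt) = 0" for P wx wxx wxxx wxxt by (simp add: F0_def nth)
  have inv_jet: "prolongation3 X F0 (jet P wx wxx wxxx wxxt)
      + wx * (p * (snd (snd P))\<^sup>2 + q * snd (snd P)) = 0" for P wx wxx wxxx wxxt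
    using inv[OF F0, of P wx wxx wxxx wxxt] by (simp add: nth)
  note K = inv_jet[unfolded prolongation3_F0[OF X smooth] prol_wt[OF X smooth]
      prol_wx[OF X smooth] prol_wxxx[OF X smooth] jet_D1_def jet_D2_def jet_D3_def on_jet nth]
  have \<beta>x: "Dx \<beta> = (\<lambda>P. 0)"
  proof
    fix P show "Dx \<beta> P = 0"
      using K[where P=P and wx=0 and wxx=0 and wxxx=0 and wxxt=1]
      K[where P=P and wx=0 and wxx=0 and wxxx=0 and wxxt=0]
      by simp
  qed
  have \<beta>w: "Dw \<beta> = (\<lambda>P. 0)"
  proof
    fix P show "Dw \<beta> P = 0"
      using K[where P=P and wx=1 and wxx=0 and wxxx=0 and wxxt=1]
      K[where P=P and wx=1 and wxx=0 and wxxx=0 and wxxt=0]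
      by (simp add: \<beta>x)
  qed
  note K' = K[unfolded \<beta>x \<beta>w dd_const]
  \<comment> \<open>The jets with \<open>w\<^sub>x\<^sub>x = 1\<close>, \<open>w\<^sub>x\<^sub>x = - 1\<close> and \<open>w\<^sub>x\<^sub>x = 0\<close> separate the coefficients of degree 0, 1, 2.\<close>
  have b_squared: "\<eta>wx * 3 - 3 * \<alpha>xx - 3 * \<alpha>w + r = 0 \<Longrightarrow> - (\<eta>wx * 3) + 3 * \<alpha>xx - 3 * \<alpha>w + r = 0
      \<Longrightarrow> r = 0 \<Longrightarrow> \<alpha>w = 0 \<and> \<eta>wx = \<alpha>xx" for \<eta>wx \<alpha>xx \<alpha>w r :: real by linarith
  have 1: "Dw \<alpha> P = 0 \<and> Dw (Dx \<eta>) P = Dx (Dx \<alpha>) P" for P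
    using K'[where P=P and wx=0 and wxx=1 and wxxx=0 and wxxt=0]
      K'[where P=P and wx=0 and wxx="- 1" and wxxx=0 and wxxt=0]
      K'[where P=P and wx=0 and wxx=0 and wxxx=0 and wxxt=0]
    by (intro b_squared[where r = "Dt \<eta> P - 6 * snd (snd P) * Dx \<eta> P + Dx (Dx (Dx \<eta>)) P"]) (simp_all add: algebra_simps)
  then have \<alpha>w: "Dw \<alpha> = (\<lambda>P. 0)" and \<eta>wx: "Dw (Dx \<eta>) = Dx (Dx \<alpha>)" by auto
  have \<alpha>xw: "Dw (Dx \<alpha>) = (\<lambda>P. 0)" and \<alpha>xxw: "Dw (Dx (Dx \<alpha>)) = (\<lambda>P. 0)"
    by (intro dd_dd_zero smooth_dd smooth \<alpha>w)+
  note K'' = K'[unfolded \<alpha>w \<alpha>xw \<alpha>xxw dd_const]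
  \<comment> \<open>The difference of \<open>w\<^sub>x\<^sub>x\<^sub>x = 1\<close> and \<open>w\<^sub>x\<^sub>x\<^sub>x = 0\<close>: the terms \<open>\<eta>\<^sub>w\<close> coming from \<open>w\<^sub>t\<close> and from
    \<open>w\<^sub>x\<^sub>x\<^sub>x\<close> cancel.\<close>
  have 2: "Dt \<beta> P = 3 * Dx \<alpha> P" for P
    using K''[where P=P and wx=0 and wxx=0 and wxxx=1 and wxxt=0]
      K''[where P=P and wx=0 and wxx=0 and wxxx=0 and wxxt=0]
      by (simp add: algebra_simps)
  have 3: "Dw (Dw \<eta>) P = 0" for P
    using K''[where P=P and wx=1 and wxx=1 and wxxx=0 and wxxt=0]
      K''[where P=P and wx=1 and wxx=0 and wxxx=0 and wxxt=0] 1[of P]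
      by (simp add: algebra_simps)
  have \<beta>t: "Dt \<beta> = (\<lambda>P. 3 * Dx \<alpha> P)" and \<eta>ww: "Dw (Dw \<eta>) = (\<lambda>P. 0)" using 2 3 by auto
  have "Dx (Dt \<beta>) = (\<lambda>P. 0)"
    by (intro dd_dd_zero smooth \<beta>x)
  moreover have "dd v (Dt \<beta>) P = 3 * dd v (Dx \<alpha>) P" for v P
    unfolding \<beta>t dd_def[of v "Dx \<alpha>"]
    by (rule dd_unique) (auto intro!: derivative_eq_intros smooth_has_derivative smooth_dd smooth)
  ultimately have \<alpha>xx: "Dx (Dx \<alpha>) = (\<lambda>P. 0)" by (auto simp: fun_eq_iff)
  have \<eta>wwx: "Dw (Dw (Dx \<eta>)) = (\<lambda>P. 0)" "Dw (Dx (Dx \<eta>)) = (\<lambda>P. 0)"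
    using dd_commute[OF smooth_dd[OF smooth(3)], of "(0,0,1)" "(1,0,0)" "(1,0,0)"] by (simp_all add: \<eta>wx \<alpha>xx)
  note K3 = K''[unfolded \<eta>wwx \<eta>wx \<eta>ww \<alpha>xx \<beta>t dd_const]
  have 4: "Dt \<eta> P - 6 * snd (snd P) * Dx \<eta> P + Dx (Dx (Dx \<eta>)) P = 0" for P
    using K3[where P=P and wx=0 and wxx=0 and wxxx=0 and wxxt=0]
      by simp
  have 5: "\<eta> P = (p * (snd (snd P))\<^sup>2 + q * snd (snd P) - 12 * snd (snd P) * Dx \<alpha> P - Dt \<alpha> P) / 6" for P
    using K3[where P=P and wx=1 and wxx=0 and wxxx=0 and wxxt=0] 4[of P] by (simp add: algebra_simps)
  have dd\<eta>: "dd v \<eta> P = (2 * p * snd (snd P) * snd (snd v) + q * snd (snd v)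
      - 12 * snd (snd v) * Dx \<alpha> P - 12 * snd (snd P) * dd v (Dx \<alpha>) P - dd v (Dt \<alpha>) P) / 6" for v P
    unfolding 5[abs_def] dd_def[of v "Dx \<alpha>"] dd_def[of v "Dt \<alpha>"]
    by (rule dd_unique) (auto intro!: derivative_eq_intros smooth_has_derivative smooth_dd smooth simp: field_simps)
  have \<alpha>xt: "Dx (Dt \<alpha>) = Dt (Dx \<alpha>)"
    using smooth(1) by (rule dd_commute)
  have \<alpha>tw: "Dw (Dt \<alpha>) = (\<lambda>P. 0)" "Dw (Dt (Dt \<alpha>)) = (\<lambda>P. 0)" "Dw (Dt (Dx \<alpha>)) = (\<lambda>P. 0)"
    and \<alpha>xtx: "Dx (Dt (Dx \<alpha>)) = (\<lambda>P. 0)"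
    by (intro dd_dd_zero smooth_dd smooth \<alpha>w \<alpha>xw \<alpha>xx)+
  note \<alpha>t = \<alpha>xt \<alpha>tw \<alpha>xtx
  define A where "A = Dt (Dx \<alpha>)"
  have A: "smooth A" "Dw A = (\<lambda>P. 0)"
    using smooth \<alpha>t by (auto simp: A_def)
  have \<eta>w: "Dw \<eta> = (\<lambda>P. (2 * p * snd (snd P) + q - 12 * Dx \<alpha> P) / 6)"
    by (auto simp: fun_eq_iff dd\<eta> \<alpha>xw \<alpha>t)
  have "Dw (Dw \<eta>) P = (2 * p - 12 * Dw (Dx \<alpha>) P) / 6" for P
    unfolding \<eta>w dd_def[of _ "Dx \<alpha>"]
    by (rule dd_unique[THEN trans])
      (auto intro!: derivative_eq_intros smooth_has_derivative smooth_dd smooth simp: field_simps)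
  then have p: "p = 0" by (simp add: \<eta>ww \<alpha>xw)
  have \<eta>x: "Dx \<eta> = (\<lambda>P. - A P / 6)"
    by (auto simp: fun_eq_iff dd\<eta> \<alpha>xx \<alpha>t A_def)
  have "dd v (Dx \<eta>) P = - dd v A P / 6" for v P
    unfolding \<eta>x dd_def[of _ A]
    by (rule dd_unique) (auto intro!: derivative_eq_intros smooth_has_derivative A)
  then have "Dx (Dx \<eta>) = (\<lambda>P. 0)" by (simp add: fun_eq_iff A_def \<alpha>t)
  then have \<eta>t: "Dt \<eta> P = - snd (snd P) * A P" for P
    using 4[of P] fun_cong[OF \<eta>x, of P] by simp
  have \<alpha>tt: "Dt (Dt \<alpha>) = (\<lambda>P. - 6 * snd (snd P) * A P)"
  proof
    fix P
    have "Dt \<eta> P = (- 12 * snd (snd P) * A P - Dt (Dt \<alpha>) P) / 6"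
      unfolding A_def by (subst dd\<eta>) simp
    then show "Dt (Dt \<alpha>) P = - 6 * snd (snd P) * A P"
      unfolding \<eta>t by (simp add: algebra_simps)
  qed
  \<comment> \<open>The left-hand side of \<open>\<alpha>tt\<close> does not depend on \<open>w\<close>, so the coefficient of \<open>w\<close> on the right vanishes.\<close>
  have "Dw (Dt (Dt \<alpha>)) P = - 6 * A P - 6 * snd (snd P) * Dw A P" for P
    unfolding \<alpha>tt dd_def[of _ A]
    by (rule dd_unique[THEN trans])
      (auto intro!: derivative_eq_intros smooth_has_derivative A simp: field_simps)
  then have A0: "A = (\<lambda>P. 0)" by (simp add: fun_eq_iff \<alpha>t A)
  obtain a where a: "Dx \<alpha> = (\<lambda>P. a)"
    using const_partials_affine[of "Dx \<alpha>" 0 0 0] smooth \<alpha>xx \<alpha>xw A0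
    by (auto simp: A_def affine_fn_def split_def)
  obtain b where b: "Dt \<alpha> = (\<lambda>P. b)"
    using const_partials_affine[of "Dt \<alpha>" 0 0 0] smooth \<alpha>t \<alpha>tt A0
    by (auto simp: A_def affine_fn_def split_def)
  obtain d where d: "\<alpha> = affine_fn d a b 0"
    using const_partials_affine[of \<alpha> a b 0] smooth \<alpha>w a b by auto
  obtain e where e: "\<beta> = affine_fn e 0 (3 * a) 0"
    using const_partials_affine[of \<beta> 0 "3 * a" 0] smooth \<beta>x \<beta>w \<beta>t a by auto
  have \<eta>: "\<eta> = (\<lambda>P. (q * snd (snd P) - 12 * snd (snd P) * a - b) / 6)"
    by (simp add: fun_eq_iff 5 p a b)
  have "X = affine_field a (b / 6) d e (q / 6 - 2 * a)"
    by (simp add: X \<eta> d e affine_field_def affine_fn_def split_def fun_eq_iff diff_divide_distrib algebra_simps)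
  with p show ?thesis by blast
qed

section \<open>First-order approximate symmetries\<close>

lemma o_eps_tendsto_0:
  assumes "o_eps f"
  shows "(f \<longlongrightarrow> 0) (at 0)"
proof -
  have "((\<lambda>\<epsilon>. \<epsilon> *\<^sub>R (f \<epsilon> /\<^sub>R \<epsilon>)) \<longlongrightarrow> 0 *\<^sub>R 0) (at 0)"
    using assms unfolding o_eps_def by (intro tendsto_intros)
  then have "((\<lambda>\<epsilon>. \<epsilon> *\<^sub>R (f \<epsilon> /\<^sub>R \<epsilon>)) \<longlongrightarrow> 0) (at 0)" by simp
  then show ?thesis
    by (rule Lim_transform_eventually) (auto simp: eventually_at_filter)
qed

lemma o_epsI:
  assumes "\<And>\<epsilon>. f \<epsilon> = \<epsilon> *\<^sub>R g \<epsilon>" "(g \<longlongrightarrow> 0) (at 0)"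
  shows "o_eps f"
  unfolding o_eps_def
  by (rule Lim_transform_eventually[OF assms(2)]) (auto simp: eventually_at_filter assms(1))

lemma o_epsD:
  assumes "o_eps f" "\<And>\<epsilon>. f \<epsilon> = \<epsilon> *\<^sub>R g \<epsilon>" "(g \<longlongrightarrow> l) (at 0)"
  shows "l = 0"
proof -
  have "(g \<longlongrightarrow> 0) (at 0)"
    using assms(1) unfolding o_eps_def
    by (rule Lim_transform_eventually) (auto simp: eventually_at_filter assms(2))
  with assms(3) show ?thesis using tendsto_unique trivial_limit_at by blast
qed

lemma o_eps_affine:
  fixes u v :: "'a::real_normed_vector"
  assumes "o_eps (\<lambda>\<epsilon>. u + \<epsilon> *\<^sub>R v)"
  shows "u = 0 \<and> v = 0"
proof -
  have "((\<lambda>\<epsilon>. u + \<epsilon> *\<^sub>R v) \<longlongrightarrow> 0) (at 0)"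
    using assms by (rule o_eps_tendsto_0)
  moreover have "((\<lambda>\<epsilon>. u + \<epsilon> *\<^sub>R v) \<longlongrightarrow> u + 0 *\<^sub>R v) (at 0)"
    by (intro tendsto_intros)
  ultimately have u: "u = 0" using tendsto_unique trivial_limit_at by fastforce
  have "v = 0" by (rule o_epsD[OF assms, of "\<lambda>_. v"]) (auto simp: u)
  with u show ?thesis by simp
qed

lemma smooth_affine_field: "smooth (affine_field a b d e m)"
proof -
  have "bounded_linear (\<lambda>(x, t, w :: real). (a * x + 6 * b * t, 3 * a * t, m * w))"
    unfolding split_def
    by (intro bounded_linear_Pair bounded_linear_add bounded_linear_const_mult bounded_linear_fst
      bounded_linear_compose[OF bounded_linear_fst bounded_linear_snd]
      bounded_linear_compose[OF bounded_linear_snd bounded_linear_snd])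
  from smooth_affine[OF this, of "(d, e, - b)"] show ?thesis
    by (simp add: affine_field_def split_def algebra_simps)
qed

text \<open>The summand \<open>(m - 3 * a) * F0 z\<close> is the multiplier of the equation; the other summands are
  the defects that have to cancel between the two orders in \<open>\<epsilon>\<close>.\<close>

lemma prolongation3_affine_field:
  shows prolongation3_F0_affine_field: "prolongation3 (affine_field a b d e m) F0 z
      = (m - 3 * a) * F0 z - 6 * (m + 2 * a) * z $ Jw * z $ Jwx"
    and prolongation3_F1_affine_field: "prolongation3 (affine_field a b d e m) F1 z
      = 12 * b * z $ Jw * z $ Jwx - (18 * m - 6 * a) * (z $ Jw)\<^sup>2 * z $ Jwx"
proof -
  let ?\<alpha> = "affine_fn d a (6 * b) 0" and ?\<beta> = "affine_fn e 0 (3 * a) 0" and ?\<eta> = "affine_fn (- b) 0 0 m"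
  have X: "affine_field a b d e m = (\<lambda>p. (?\<alpha> p, ?\<beta> p, ?\<eta> p))"
    by (auto simp: affine_field_def affine_fn_def)
  have \<eta>: "on_jets ?\<eta> z = m * z $ Jw - b"
    by (simp add: on_jets_def affine_fn_def base_def)
  note smooth = smooth_affine_fn smooth_affine_fn smooth_affine_fn
  have const: "on_jets (\<lambda>p. c) z = c" for c by (simp add: on_jets_def)
  note formulas = prol_wt[OF X smooth] prol_wx[OF X smooth] prol_wxxx[OF X smooth]
      jet_D1_def jet_D2_def jet_D3_def
  show "prolongation3 (affine_field a b d e m) F0 z
      = (m - 3 * a) * F0 z - 6 * (m + 2 * a) * z $ Jw * z $ Jwx"
    unfolding prolongation3_F0[OF X smooth] formulas
    by (simp add: const \<eta> F0_def algebra_simps)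
  show "prolongation3 (affine_field a b d e m) F1 z
      = 12 * b * z $ Jw * z $ Jwx - (18 * m - 6 * a) * (z $ Jw)\<^sup>2 * z $ Jwx"
    unfolding prolongation3_F1[OF X smooth] formulas
    by (simp add: const \<eta> algebra_simps power2_eq_square)
qed

text \<open>Along the test family \<open>zs z0\<close> the function \<open>F_gardner \<epsilon>\<close> vanishes identically, because \<open>F1\<close>
  does not depend on \<open>w\<^sub>t\<close>. The limit of the condition gives the determining equations for \<open>X0\<close>.
  Once \<open>X0\<close> is known, its prolongation on the family equals \<open>- 5 a F0 = 5 a \<epsilon> F1 z0\<close>, the whole
  condition is divisible by \<open>\<epsilon>\<close>, and the limit of the quotient gives the determining equations
  with source for \<open>X1\<close>.\<close>

lemma approx_symmetry_imp_affine_field: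
  assumes "approx_symmetry X0 X1"
  shows "\<exists>b d e a1 b1 d1 e1. X0 = affine_field 0 b d e 0 \<and> X1 = affine_field a1 b1 d1 e1 (2 * b - 2 * a1)"
proof -
  have smooth: "smooth X0" "smooth X1" using assms by (auto simp: approx_symmetry_def)
  define zs where "zs z0 \<epsilon> = z0 - (\<epsilon> * F1 z0) *\<^sub>R axis Jwt 1" for z0 :: jet and \<epsilon> :: real
  have lim: "(zs z0 \<longlongrightarrow> z0) (at 0)" for z0
    by (auto simp: zs_def[abs_def] intro!: tendsto_eq_intros)
  have F1: "F1 (zs z0 \<epsilon>) = F1 z0" and F0: "F0 (zs z0 \<epsilon>) = F0 z0 - \<epsilon> * F1 z0" for z0 \<epsilon>
    by (simp_all add: zs_def F0_def F1_def axis_def)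
  have o: "o_eps (\<lambda>\<epsilon>. prolongation3 (first_order_op X0 X1 \<epsilon>) (F_gardner \<epsilon>) (zs z0 \<epsilon>))"
    if "F0 z0 = 0" for z0
  proof -
    have "o_eps (\<lambda>\<epsilon>. F_gardner \<epsilon> (zs z0 \<epsilon>))"
      by (rule o_epsI[of _ "\<lambda>_. 0"]) (simp_all add: F_gardner_def F0 F1 that)
    with assms lim[of z0] show ?thesis by (auto simp: approx_symmetry_def)
  qed
  note expand = prolongation3_F_gardner prolongation3_first_order_op[OF smooth]
  note cont = isCont_tendsto_compose[OF prolongation3_continuous(1) lim]
    isCont_tendsto_compose[OF prolongation3_continuous(2) lim]
  obtain \<alpha> \<beta> \<eta> where X0: "X0 = (\<lambda>p. (\<alpha> p, \<beta> p, \<eta> p))"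
    and s0: "smooth \<alpha>" "smooth \<beta>" "smooth \<eta>" using smooth_components[OF smooth(1)] .
  obtain \<alpha>' \<beta>' \<eta>' where X1: "X1 = (\<lambda>p. (\<alpha>' p, \<beta>' p, \<eta>' p))"
    and s1: "smooth \<alpha>'" "smooth \<beta>'" "smooth \<eta>'" using smooth_components[OF smooth(2)] .
  have "prolongation3 X0 F0 z0 = 0" if z0: "F0 z0 = 0" for z0
  proof -
    have "((\<lambda>\<epsilon>. prolongation3 (first_order_op X0 X1 \<epsilon>) (F_gardner \<epsilon>) (zs z0 \<epsilon>))
        \<longlongrightarrow> (prolongation3 X0 F0 z0 + 0 * prolongation3 X1 F0 z0)
            + 0 * (prolongation3 X0 F1 z0 + 0 * prolongation3 X1 F1 z0)) (at 0)"
      unfolding expand by (intro tendsto_intros cont smooth)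
    with o_eps_tendsto_0[OF o[OF z0]] show ?thesis
      using tendsto_unique trivial_limit_at by fastforce
  qed
  then obtain a b d e where X0': "X0 = affine_field a b d e (- 2 * a)"
    using determining_equations_solution[OF X0 s0, of 0 0] by auto
  have "prolongation3 X1 F0 z0 + z0 $ Jwx * (12 * a * (z0 $ Jw)\<^sup>2 + 12 * b * z0 $ Jw) = 0"
    if z0: "F0 z0 = 0" for z0
  proof -
    have "5 * a * F1 z0 + prolongation3 X1 F0 z0
        + (prolongation3 X0 F1 z0 + 0 * prolongation3 X1 F1 z0) = 0"
    proof (rule o_epsD[OF o[OF z0]])
      show "((\<lambda>\<epsilon>. 5 * a * F1 z0 + prolongation3 X1 F0 (zs z0 \<epsilon>)
        + (prolongation3 X0 F1 (zs z0 \<epsilon>) + \<epsilon> * prolongation3 X1 F1 (zs z0 \<epsilon>)))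
        \<longlongrightarrow> 5 * a * F1 z0 + prolongation3 X1 F0 z0
        + (prolongation3 X0 F1 z0 + 0 * prolongation3 X1 F1 z0)) (at 0)"
        by (intro tendsto_intros cont smooth)
      show "prolongation3 (first_order_op X0 X1 \<epsilon>) (F_gardner \<epsilon>) (zs z0 \<epsilon>)
        = \<epsilon> *\<^sub>R (5 * a * F1 z0 + prolongation3 X1 F0 (zs z0 \<epsilon>)
        + (prolongation3 X0 F1 (zs z0 \<epsilon>) + \<epsilon> * prolongation3 X1 F1 (zs z0 \<epsilon>)))" for \<epsilon>
        unfolding expand
        by (simp add: X0' prolongation3_F0_affine_field F0 z0 algebra_simps)
    qed
    then show ?thesis
      by (simp add: X0' prolongation3_F1_affine_field F1_def algebra_simps)
  qed
  from determining_equations_solution[OF X1 s1 this]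
  obtain a1 b1 d1 e1 where "a = 0" "X1 = affine_field a1 b1 d1 e1 (2 * b - 2 * a1)" by auto
  with X0' have "X0 = affine_field 0 b d e 0 \<and> X1 = affine_field a1 b1 d1 e1 (2 * b - 2 * a1)" by simp
  then show ?thesis by blast
qed

text \<open>The index \<open>1\<close> of the first operator must stay a numeral like the other six.\<close>

declare One_nat_def [simp del]

lemma sum_7:
  fixes f :: "nat \<Rightarrow> 'a::comm_monoid_add"
  shows "(\<Sum>i = 1..7. f i) = f 1 + f 2 + f 3 + f 4 + f 5 + f 6 + f 7"
  by (simp add: eval_nat_numeral atLeastAtMostSuc_conv add_ac One_nat_def)

lemma lin_comb_gardner_op:
  "lin_comb 7 gardner_op c \<epsilon> = affine_field (\<epsilon> * c 7) (c 3 + \<epsilon> * c 6) (c 1 + \<epsilon> * c 4) (c 2 + \<epsilon> * c 5)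
     (\<epsilon> * (2 * c 3 - 2 * c 7))"
  by (auto simp: fun_eq_iff lin_comb_def sum_7 gardner_op_def affine_field_def algebra_simps)

lemma affine_field_first_order:
  "affine_field (\<epsilon> * c 7) (c 3 + \<epsilon> * c 6) (c 1 + \<epsilon> * c 4) (c 2 + \<epsilon> * c 5) (\<epsilon> * (2 * c 3 - 2 * c 7))
    = first_order_op (affine_field 0 (c 3) (c 1) (c 2) 0) (affine_field (c 7) (c 6) (c 4) (c 5) (2 * c 3 - 2 * c 7)) \<epsilon>"
  by (auto simp: fun_eq_iff first_order_op_def affine_field_def algebra_simps)

lemma approx_eq_lin_comb_iff:
  "first_order_op X0 X1 \<approx>\<^sub>\<epsilon> lin_comb 7 gardner_op c \<longleftrightarrow>
    X0 = affine_field 0 (c 3) (c 1) (c 2) 0 \<and> X1 = affine_field (c 7) (c 6) (c 4) (c 5) (2 * c 3 - 2 * c 7)"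
    (is "?L \<longleftrightarrow> X0 = ?Y0 \<and> X1 = ?Y1")
proof
  assume L: ?L
  have "X0 p - ?Y0 p = 0 \<and> X1 p - ?Y1 p = 0" for p
  proof (rule o_eps_affine)
    have "o_eps (\<lambda>\<epsilon>. first_order_op X0 X1 \<epsilon> p - first_order_op ?Y0 ?Y1 \<epsilon> p)"
      using L by (simp add: approx_eq_def lin_comb_gardner_op affine_field_first_order del: split_paired_All)
    then show "o_eps (\<lambda>\<epsilon>. X0 p - ?Y0 p + \<epsilon> *\<^sub>R (X1 p - ?Y1 p))"
      by (simp add: first_order_op_def algebra_simps)
  qed
  then show "X0 = ?Y0 \<and> X1 = ?Y1" by auto
next
  assume "X0 = ?Y0 \<and> X1 = ?Y1"
  then show ?L
    by (simp add: approx_eq_def lin_comb_gardner_op affine_field_first_order o_eps_def)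
qed

text \<open>The order-zero part annihilates \<open>F0\<close> exactly, and the terms \<open>12 (c 3) w w\<^sub>x\<close> at order one
  cancel between the corrected boost acting on \<open>F0\<close> and the boost acting on \<open>F1\<close>. What remains is
  \<open>\<epsilon>\<close> times a multiple of \<open>F0\<close>, which tends to zero along every admissible family, plus terms of
  order \<open>\<epsilon>\<^sup>2\<close>.\<close>

lemma affine_field_imp_approx_symmetry:
  "approx_symmetry (affine_field 0 (c 3) (c 1) (c 2) 0) (affine_field (c 7) (c 6) (c 4) (c 5) (2 * c 3 - 2 * c 7))"
  unfolding approx_symmetry_def
proof (intro conjI smooth_affine_field allI impI)
  fix z :: "real \<Rightarrow> jet" and z0
  assume z: "(z \<longlongrightarrow> z0) (at 0)" and o: "o_eps (\<lambda>\<epsilon>. F_gardner \<epsilon> (z \<epsilon>))"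
  have lim: "((\<lambda>\<epsilon>. z \<epsilon> $ j) \<longlongrightarrow> z0 $ j) (at 0)" for j
    using z by (rule tendsto_vec_nth)
  have "((\<lambda>\<epsilon>. F_gardner \<epsilon> (z \<epsilon>) - \<epsilon> * F1 (z \<epsilon>)) \<longlongrightarrow> 0 - 0 * F1 z0) (at 0)"
    using o_eps_tendsto_0[OF o] unfolding F1_def by (intro tendsto_intros lim)
  then have F0: "((\<lambda>\<epsilon>. F0 (z \<epsilon>)) \<longlongrightarrow> 0) (at 0)"
    by (simp add: F_gardner_def)
  let ?X = "first_order_op (affine_field 0 (c 3) (c 1) (c 2) 0) (affine_field (c 7) (c 6) (c 4) (c 5) (2 * c 3 - 2 * c 7))"
  show "o_eps (\<lambda>\<epsilon>. prolongation3 (?X \<epsilon>) (F_gardner \<epsilon>) (z \<epsilon>))"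
  proof (rule o_epsI)
    show "prolongation3 (?X \<epsilon>) (F_gardner \<epsilon>) (z \<epsilon>) = \<epsilon> *\<^sub>R ((2 * c 3 - 5 * c 7) * F0 (z \<epsilon>)
        + \<epsilon> * (12 * c 6 * z \<epsilon> $ Jw * z \<epsilon> $ Jwx
               - (36 * c 3 - 42 * c 7) * (z \<epsilon> $ Jw)\<^sup>2 * z \<epsilon> $ Jwx))" for \<epsilon>
      unfolding affine_field_first_order[symmetric]
      by (simp add: prolongation3_F_gardner prolongation3_F0_affine_field prolongation3_F1_affine_field algebra_simps)
    have "((\<lambda>\<epsilon>. (2 * c 3 - 5 * c 7) * F0 (z \<epsilon>) + \<epsilon> * (12 * c 6 * z \<epsilon> $ Jw * z \<epsilon> $ Jwx
               - (36 * c 3 - 42 * c 7) * (z \<epsilon> $ Jw)\<^sup>2 * z \<epsilon> $ Jwx)) \<longlongrightarrow>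
        (2 * c 3 - 5 * c 7) * 0 + 0 * (12 * c 6 * z0 $ Jw * z0 $ Jwx
               - (36 * c 3 - 42 * c 7) * (z0 $ Jw)\<^sup>2 * z0 $ Jwx)) (at 0)"
      by (intro tendsto_intros lim F0)
    then show "((\<lambda>\<epsilon>. (2 * c 3 - 5 * c 7) * F0 (z \<epsilon>) + \<epsilon> * (12 * c 6 * z \<epsilon> $ Jw * z \<epsilon> $ Jwx
               - (36 * c 3 - 42 * c 7) * (z \<epsilon> $ Jw)\<^sup>2 * z \<epsilon> $ Jwx)) \<longlongrightarrow> 0) (at 0)"
      by simp
  qed
qed

lemma approx_symmetry_iff:
  "approx_symmetry X0 X1 \<longleftrightarrow> (\<exists>c. first_order_op X0 X1 \<approx>\<^sub>\<epsilon> lin_comb 7 gardner_op c)"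
proof
  assume "approx_symmetry X0 X1"
  then obtain b d e a1 b1 d1 e1
    where "X0 = affine_field 0 b d e 0" "X1 = affine_field a1 b1 d1 e1 (2 * b - 2 * a1)"
    using approx_symmetry_imp_affine_field by blast
  then have "first_order_op X0 X1 \<approx>\<^sub>\<epsilon> lin_comb 7 gardner_op
      (\<lambda>i. if i = 1 then d else if i = 2 then e else if i = 3 then b else if i = 4 then d1
        else if i = 5 then e1 else if i = 6 then b1 else a1)"
    by (simp add: approx_eq_lin_comb_iff)
  then show "\<exists>c. first_order_op X0 X1 \<approx>\<^sub>\<epsilon> lin_comb 7 gardner_op c" by blast
next
  assume "\<exists>c. first_order_op X0 X1 \<approx>\<^sub>\<epsilon> lin_comb 7 gardner_op c"
  then show "approx_symmetry X0 X1"
    using affine_field_imp_approx_symmetry by (auto simp: approx_eq_lin_comb_iff)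
qed

section \<open>The approximate Lie algebra\<close>

lemma lin_comb_independent:
  assumes "lin_comb 7 gardner_op c \<approx>\<^sub>\<epsilon> op_zero" "i \<in> {1..7}"
  shows "c i = 0"
proof -
  let ?Y0 = "affine_field 0 (c 3) (c 1) (c 2) 0" and ?Y1 = "affine_field (c 7) (c 6) (c 4) (c 5) (2 * c 3 - 2 * c 7)"
  have "?Y0 p = 0 \<and> ?Y1 p = 0" for p
    using assms(1) by (intro o_eps_affine)
      (simp add: approx_eq_def lin_comb_gardner_op affine_field_first_order first_order_op_def op_zero_def
        del: split_paired_All)
  from this[of "(0, 0, 0)"] this[of "(1, 0, 0)"]
  have "c 1 = 0" "c 2 = 0" "c 3 = 0" "c 4 = 0" "c 5 = 0" "c 6 = 0" "c 7 = 0"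
    by (auto simp: affine_field_def zero_prod_def)
  moreover have "i = 1 \<or> i = 2 \<or> i = 3 \<or> i = 4 \<or> i = 5 \<or> i = 6 \<or> i = 7"
    using assms(2) by auto
  ultimately show ?thesis by auto
qed

lemma affine_field_has_derivative:
  "(affine_field a b d e m has_derivative (\<lambda>(x, t, w). (a * x + 6 * b * t, 3 * a * t, m * w))) (at p)"
  unfolding affine_field_def split_def by (auto intro!: derivative_eq_intros)

lemma commutator_affine_field:
  "commutator (affine_field a b d e m) (affine_field a' b' d' e' m') (x, t, w) =
     (12 * (a * b' - a' * b) * t + (a' * d - a * d') + 6 * (b' * e - b * e'),
      3 * (a' * e - a * e'), m * b' - m' * b)"
  unfolding commutator_def frechet_derivative_at[OF affine_field_has_derivative, symmetric]
  by (simp add: affine_field_def algebra_simps)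

text \<open>The Lie bracket on coefficient vectors given by the claimed structure constants.\<close>

definition bracket :: "(nat \<Rightarrow> real) \<Rightarrow> (nat \<Rightarrow> real) \<Rightarrow> nat \<Rightarrow> real" where
  "bracket a b i =
    (if i = 1 then 6 * (a 2 * b 3 - a 3 * b 2)
     else if i = 4 then (a 1 * b 7 - a 7 * b 1) + 6 * (a 2 * b 6 - a 6 * b 2) - 6 * (a 3 * b 5 - a 5 * b 3)
     else if i = 5 then 3 * (a 2 * b 7 - a 7 * b 2)
     else if i = 6 then - 2 * (a 3 * b 7 - a 7 * b 3)
     else 0)"

text \<open>The commutator is a polynomial of degree two in \<open>\<epsilon>\<close>; its parts of degree zero and one form
  the combination with coefficients \<open>bracket a b\<close>, and the rest is \<open>\<epsilon>\<^sup>2\<close> times a fixed vector.\<close>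

lemma commutator_lin_comb:
  "op_commutator (lin_comb 7 gardner_op a) (lin_comb 7 gardner_op b)
    \<approx>\<^sub>\<epsilon> lin_comb 7 gardner_op (bracket a b)"
  unfolding approx_eq_def
proof
  fix p :: pt
  obtain x t w where p: "p = (x, t, w)" by (cases p)
  show "o_eps (\<lambda>\<epsilon>. op_commutator (lin_comb 7 gardner_op a) (lin_comb 7 gardner_op b) \<epsilon> p
      - lin_comb 7 gardner_op (bracket a b) \<epsilon> p)"
  proof (rule o_epsI)
    let ?v = "(12 * (a 7 * b 6 - b 7 * a 6) * t + (b 7 * a 4 - a 7 * b 4) + 6 * (b 6 * a 5 - a 6 * b 5),
        3 * (b 7 * a 5 - a 7 * b 5),
        (2 * a 3 - 2 * a 7) * b 6 - (2 * b 3 - 2 * b 7) * a 6)"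
    show "op_commutator (lin_comb 7 gardner_op a) (lin_comb 7 gardner_op b) \<epsilon> p
      - lin_comb 7 gardner_op (bracket a b) \<epsilon> p = \<epsilon> *\<^sub>R (\<epsilon> *\<^sub>R ?v)" for \<epsilon>
      unfolding op_commutator_def lin_comb_gardner_op p commutator_affine_field
      by (simp add: bracket_def affine_field_def algebra_simps)
    have "((\<lambda>\<epsilon>. \<epsilon> *\<^sub>R ?v) \<longlongrightarrow> 0 *\<^sub>R ?v) (at 0)" by (intro tendsto_intros)
    then show "((\<lambda>\<epsilon>. \<epsilon> *\<^sub>R ?v) \<longlongrightarrow> 0) (at 0)" by (simp only: scaleR_zero_left)
  qed
qed

definition unit_coeff :: "nat \<Rightarrow> nat \<Rightarrow> real" where
  "unit_coeff i k = (if k = i then 1 else 0)"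

lemma gardner_op_unit_coeff: "i \<in> {1..7} \<Longrightarrow> gardner_op i = lin_comb 7 gardner_op (unit_coeff i)"
proof -
  assume "i \<in> {1..7}"
  moreover have "unit_coeff i k *\<^sub>R v = (if k = i then v else 0)" for k and v :: pt
    by (simp add: unit_coeff_def)
  ultimately show ?thesis
    by (simp add: fun_eq_iff lin_comb_def)
qed

lemma commutator_gardner_op:
  assumes "i \<in> {1..7}" "j \<in> {1..7}" "\<And>\<epsilon>. lin_comb 7 gardner_op (bracket (unit_coeff i) (unit_coeff j)) \<epsilon> = Y \<epsilon>"
  shows "op_commutator (gardner_op i) (gardner_op j) \<approx>\<^sub>\<epsilon> Y"
proof -
  have "lin_comb 7 gardner_op (bracket (unit_coeff i) (unit_coeff j)) = Y" using assms(3) by blast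
  then show ?thesis
    using commutator_lin_comb[of "unit_coeff i" "unit_coeff j"] gardner_op_unit_coeff assms(1,2) by simp
qed

theorem mainTheorem1:
  "(\<forall>X0 X1. approx_symmetry X0 X1 \<longleftrightarrow>
      (\<exists>c. first_order_op X0 X1 \<approx>\<^sub>\<epsilon> lin_comb 7 gardner_op c)) \<and>
   spans_approx_lie_algebra_of_dim 7 gardner_op \<and>
   op_commutator (gardner_op 1) (gardner_op 7) \<approx>\<^sub>\<epsilon> gardner_op 4 \<and>
   op_commutator (gardner_op 2) (gardner_op 3) \<approx>\<^sub>\<epsilon> op_scale 6 (gardner_op 1) \<and>
   op_commutator (gardner_op 2) (gardner_op 6) \<approx>\<^sub>\<epsilon> op_scale 6 (gardner_op 4) \<and>
   op_commutator (gardner_op 2) (gardner_op 7) \<approx>\<^sub>\<epsilon> op_scale 3 (gardner_op 5) \<and>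
   op_commutator (gardner_op 3) (gardner_op 5) \<approx>\<^sub>\<epsilon> op_scale (- 6) (gardner_op 4) \<and>
   op_commutator (gardner_op 3) (gardner_op 7) \<approx>\<^sub>\<epsilon> op_scale (- 2) (gardner_op 6) \<and>
   (\<forall>i j. 1 \<le> i \<and> i < j \<and> j \<le> 7 \<and>
      (i, j) \<notin> {(1, 7), (2, 3), (2, 6), (2, 7), (3, 5), (3, 7)} \<longrightarrow>
      op_commutator (gardner_op i) (gardner_op j) \<approx>\<^sub>\<epsilon> op_zero)"
proof (intro conjI allI impI)
  show "approx_symmetry X0 X1 \<longleftrightarrow> (\<exists>c. first_order_op X0 X1 \<approx>\<^sub>\<epsilon> lin_comb 7 gardner_op c)" for X0 X1
    by (rule approx_symmetry_iff)
  show "spans_approx_lie_algebra_of_dim 7 gardner_op"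
    unfolding spans_approx_lie_algebra_of_dim_def
    using lin_comb_independent commutator_lin_comb by blast
  note explicit = fun_eq_iff lin_comb_gardner_op bracket_def unit_coeff_def affine_field_def gardner_op_def op_scale_def
  show "op_commutator (gardner_op 1) (gardner_op 7) \<approx>\<^sub>\<epsilon> gardner_op 4"
    by (rule commutator_gardner_op) (auto simp: explicit)
  show "op_commutator (gardner_op 2) (gardner_op 3) \<approx>\<^sub>\<epsilon> op_scale 6 (gardner_op 1)"
    by (rule commutator_gardner_op) (auto simp: explicit)
  show "op_commutator (gardner_op 2) (gardner_op 6) \<approx>\<^sub>\<epsilon> op_scale 6 (gardner_op 4)"
    by (rule commutator_gardner_op) (auto simp: explicit)
  show "op_commutator (gardner_op 2) (gardner_op 7) \<approx>\<^sub>\<epsilon> op_scale 3 (gardner_op 5)"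
    by (rule commutator_gardner_op) (auto simp: explicit)
  show "op_commutator (gardner_op 3) (gardner_op 5) \<approx>\<^sub>\<epsilon> op_scale (- 6) (gardner_op 4)"
    by (rule commutator_gardner_op) (auto simp: explicit)
  show "op_commutator (gardner_op 3) (gardner_op 7) \<approx>\<^sub>\<epsilon> op_scale (- 2) (gardner_op 6)"
    by (rule commutator_gardner_op) (auto simp: explicit)
next
  fix i j :: nat
  assume ij: "1 \<le> i \<and> i < j \<and> j \<le> 7 \<and> (i, j) \<notin> {(1, 7), (2, 3), (2, 6), (2, 7), (3, 5), (3, 7)}"
  then have "bracket (unit_coeff i) (unit_coeff j) = (\<lambda>k. 0)"
    by (auto simp: fun_eq_iff bracket_def unit_coeff_def)
  then show "op_commutator (gardner_op i) (gardner_op j) \<approx>\<^sub>\<epsilon> op_zero"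
    using ij by (intro commutator_gardner_op) (auto simp: fun_eq_iff lin_comb_def op_zero_def)
qed

end
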